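(* Let $p$ be a prime, $1\le r'\le r$ integers, $N=p^r$, $N'=p^{r'}$ and $L=L_{N,N'}$. For a subgroup $H\subseteq L'/L$ let $v^H=\sum_{\gamma\in H}\mathfrak{e}_\gamma\in\mathbb{C}[L'/L]$ be its characteristic function. Then $$\sum_{a\in p\mathbb{Z}/p^{r'}\mathbb{Z}}v^{H^1_{a,1}}+\sum_{c\in p^{r-r'+1}\mathbb{Z}/p^r\mathbb{Z}}v^{H^1_{1,c}}+\sum_{\substack{u\in(\mathbb{Z}/p^{r'}\mathbb{Z})^\times\\0\le s\le r-r'}}v^{H^1_{1,up^s}}=\sum_{a\in p\mathbb{Z}/p^{r'}\mathbb{Z}}v^{H^2_{a,1}}+\sum_{c\in p^{r-r'+1}\mathbb{Z}/p^r\mathbb{Z}}v^{H^2_{1,c}}+\sum_{\substack{u\in(\mathbb{Z}/p^{r'}\mathbb{Z})^\times\\0\le s\le r-r'}}v^{H^2_{1,up^s}},$$ and this is, up to multiplication by scalars, the only non-trivial linear relation among the characteristic functions $v^H$, $H\in\mathrm{Types}(L)$, of types of one-dimensional cusps.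
   Context: For positive integers $N'\mid N$, $L_{N,N'}=\left\{\begin{pmatrix}a&b\\c&d\end{pmatrix}\in M_2(\mathbb{Z}) : \frac{N}{N'}\mid c\right\}$ with quadratic form $q(X)=-N'\det X$ (isometric to $U(N)\oplus U(N')$, $U$ the hyperbolic plane). $L'$ is the dual lattice and $V=L\otimes\mathbb{Q}=M_2(\mathbb{Q})$. The map $\begin{pmatrix}a'&b'\\c'&d'\end{pmatrix}\mapsto(Nb',N'c',N'a',-N'd')$ identifies $L'/L$ with $(\mathbb{Z}/N\mathbb{Z})^2\oplus(\mathbb{Z}/N'\mathbb{Z})^2$ with quadratic form $q(w,x,y,z)=\frac{wx}{N}+\frac{yz}{N'}\in\mathbb{Q}/\mathbb{Z}$. $\mathbb{C}[L'/L]$ has standard basis $\mathfrak{e}_\gamma$, $\gamma\in L'/L$. For coprime integers $a,c$ with $c\ge0$, let $I^1_{a,c}\subset V$ be the isotropic plane spanned by $\begin{pmatrix}a&0\\c&0\end{pmatrix},\begin{pmatrix}0&a\\0&c\end{pmatrix}$ and $I^2_{a,c}$ the isotropic plane spanned by $\begin{pmatrix}0&0\\c&a\end{pmatrix},\begin{pmatrix}c&a\\0&0\end{pmatrix}$; these are all the $2$-dimensional isotropic subspaces of $V$, which correspond to the one-dimensional rational boundary components. The type of an isotropic plane $I$ is $\mathrm{type}_L(I)=(I\cap L')/(I\cap L)\subseteq L'/L$; $H^*_{a,c}=\mathrm{type}_L(I^*_{a,c})$ for $*=1,2$, and $\mathrm{Types}(L)$ is the set of all types. Explicitly, with $M=\gcd(N/N',c)$,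 $H^1_{a,c}$ is generated by $(\frac{Na}{N'M},0,0,-\frac cM)$ and $(0,c,a,0)$, and $H^2_{a,c}$ by $(\frac{Na}{N'M},0,\frac cM,0)$ and $(0,c,0,-a)$. In the sums, residue classes are represented by arbitrary non-negative integer representatives (for $u$, representatives prime to $p$); the subgroups $H^*_{a,1}$, $H^*_{1,c}$, $H^*_{1,up^s}$ occurring there do not depend on the choice. *)

theory Defs
  imports
    "HOL-Analysis.Determinants"
    "HOL-Algebra.Coset"
    "HOL-Number_Theory.Cong"
    "HOL-Library.Function_Algebras"
begin

section \<open>The rational quadratic space and the lattice\<close>

definition mat22 :: "rat \<Rightarrow> rat \<Rightarrow> rat \<Rightarrow> rat \<Rightarrow> rat^2^2" where
  "mat22 a b c d = vector [vector [a, b], vector [c, d]]"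

text \<open>The type \<open>rat^2^2\<close> comes with componentwise addition; its structure as a vector space
  over the rationals is given by the following scaling.\<close>

definition mscale :: "rat \<Rightarrow> rat^2^2 \<Rightarrow> rat^2^2" where
  "mscale t X = (\<chi> i j. t * X $ i $ j)"

interpretation mat: vector_space mscale
  by unfold_locales (simp_all add: mscale_def vec_eq_iff algebra_simps)

definition qform :: "nat \<Rightarrow> rat^2^2 \<Rightarrow> rat" where
  "qform N' X = - of_nat N' * det X"

definition bform :: "nat \<Rightarrow> rat^2^2 \<Rightarrow> rat^2^2 \<Rightarrow> rat" where
  "bform N' X Y = qform N' (X + Y) - qform N' X - qform N' Y"

definition latt :: "nat \<Rightarrow> nat \<Rightarrow> (rat^2^2) set" where
  "latt N N' = {mat22 (of_int a) (of_int b) (of_int c) (of_int d) | a b c d :: int.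
     int (N div N') dvd c}"

definition dual_lattice :: "nat \<Rightarrow> nat \<Rightarrow> (rat^2^2) set" where
  "dual_lattice N N' = {Y. \<forall>X\<in>latt N N'. bform N' X Y \<in> \<int>}"

definition dual_group :: "nat \<Rightarrow> nat \<Rightarrow> (rat^2^2) monoid" where
  "dual_group N N' = \<lparr>carrier = dual_lattice N N', mult = (+), one = 0\<rparr>"

text \<open>The discriminant group $L'/L$; its elements are the cosets of the lattice.\<close>

definition disc_group :: "nat \<Rightarrow> nat \<Rightarrow> (rat^2^2) set monoid" where
  "disc_group N N' = dual_group N N' Mod latt N N'"

section \<open>Isotropic planes and their types\<close>

definition isotropic_plane :: "nat \<Rightarrow> (rat^2^2) set \<Rightarrow> bool" where
  "isotropic_plane N' I \<longleftrightarrow> mat.subspace I \<and> mat.dim I = 2 \<and> (\<forall>X\<in>I. qform N' X = 0)"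

definition plane1 :: "int \<Rightarrow> int \<Rightarrow> (rat^2^2) set" where
  "plane1 a c = mat.span {mat22 (of_int a) 0 (of_int c) 0, mat22 0 (of_int a) 0 (of_int c)}"

definition plane2 :: "int \<Rightarrow> int \<Rightarrow> (rat^2^2) set" where
  "plane2 a c = mat.span {mat22 0 0 (of_int c) (of_int a), mat22 (of_int c) (of_int a) 0 0}"

text \<open>The quotient $(I \cap L')/(I \cap L)$, embedded into $L'/L$ as the set of all cosets
  of $L$ that are represented by elements of $I \cap L'$.\<close>

definition type_of :: "nat \<Rightarrow> nat \<Rightarrow> (rat^2^2) set \<Rightarrow> (rat^2^2) set set" where
  "type_of N N' I = (\<lambda>X. latt N N' #>\<^bsub>dual_group N N'\<^esub> X) ` (I \<inter> dual_lattice N N')"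

definition Types :: "nat \<Rightarrow> nat \<Rightarrow> (rat^2^2) set set set" where
  "Types N N' = {type_of N N' I | I. isotropic_plane N' I}"

definition H1 :: "nat \<Rightarrow> nat \<Rightarrow> nat \<Rightarrow> nat \<Rightarrow> (rat^2^2) set set" where
  "H1 N N' a c = type_of N N' (plane1 (int a) (int c))"

definition H2 :: "nat \<Rightarrow> nat \<Rightarrow> nat \<Rightarrow> nat \<Rightarrow> (rat^2^2) set set" where
  "H2 N N' a c = type_of N N' (plane2 (int a) (int c))"

text \<open>The lattice is a normal subgroup of its dual, and types are subgroups of the discriminant
  group.\<close>

lemma bform_eq:
  "bform N' X Y = - of_nat N' * (X$1$1 * Y$2$2 + X$2$2 * Y$1$1 - X$1$2 * Y$2$1 - X$2$1 * Y$1$2)"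
  by (simp add: bform_def qform_def det_2 algebra_simps)

lemma latt_iff:
  "X \<in> latt N N' \<longleftrightarrow> (\<exists>a b c d :: int. int (N div N') dvd c \<and>
     X$1$1 = of_int a \<and> X$1$2 = of_int b \<and> X$2$1 = of_int c \<and> X$2$2 = of_int d)"
  by (auto simp: latt_def mat22_def vec_eq_iff forall_2)

lemma dual_lattice_0: "0 \<in> dual_lattice N N'"
  by (simp add: dual_lattice_def bform_eq)

lemma dual_lattice_add:
  assumes "X \<in> dual_lattice N N'" "Y \<in> dual_lattice N N'"
  shows "X + Y \<in> dual_lattice N N'"
proof -
  have "bform N' Z (X + Y) = bform N' Z X + bform N' Z Y" for Z
    by (simp add: bform_eq algebra_simps)
  with assms show ?thesis by (simp add: dual_lattice_def)
qed

lemma dual_lattice_minus: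
  assumes "X \<in> dual_lattice N N'"
  shows "- X \<in> dual_lattice N N'"
proof -
  have "bform N' Z (- X) = - bform N' Z X" for Z
    by (simp add: bform_eq algebra_simps)
  with assms show ?thesis by (simp add: dual_lattice_def)
qed

lemma latt_subset_dual: "latt N N' \<subseteq> dual_lattice N N'"
  by (auto simp: dual_lattice_def bform_eq latt_iff)

lemma comm_group_dual_group: "comm_group (dual_group N N')"
proof (rule comm_groupI)
  fix X assume "X \<in> carrier (dual_group N N')"
  thus "\<exists>Y\<in>carrier (dual_group N N'). Y \<otimes>\<^bsub>dual_group N N'\<^esub> X = \<one>\<^bsub>dual_group N N'\<^esub>"
    by (intro bexI[of _ "- X"]) (simp_all add: dual_group_def dual_lattice_minus)
qed (simp_all add: dual_group_def dual_lattice_0 dual_lattice_add algebra_simps)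

lemma inv_dual_group:
  assumes "X \<in> dual_lattice N N'"
  shows "inv\<^bsub>dual_group N N'\<^esub> X = - X"
proof -
  interpret comm_group "dual_group N N'" by (rule comm_group_dual_group)
  show ?thesis
    using assms by (intro inv_equality) (simp_all add: dual_group_def dual_lattice_minus)
qed

lemma subgroup_dual_group:
  assumes "S \<subseteq> dual_lattice N N'" "0 \<in> S"
    and "\<And>X Y. X \<in> S \<Longrightarrow> Y \<in> S \<Longrightarrow> X + Y \<in> S" "\<And>X. X \<in> S \<Longrightarrow> - X \<in> S"
  shows "subgroup S (dual_group N N')"
proof (rule subgroup.intro)
  fix X assume "X \<in> S"
  thus "inv\<^bsub>dual_group N N'\<^esub> X \<in> S"
    using assms by (subst inv_dual_group) auto
qed (use assms in \<open>auto simp: dual_group_def\<close>)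

lemma normal_latt: "latt N N' \<lhd> dual_group N N'"
proof (rule comm_group.subgroup_imp_normal[OF comm_group_dual_group], rule subgroup_dual_group)
  show "0 \<in> latt N N'"
    by (simp add: latt_iff)
  show "X + Y \<in> latt N N'" if "X \<in> latt N N'" "Y \<in> latt N N'" for X Y
    using that by (simp add: latt_iff) (metis dvd_add of_int_add)
  show "- X \<in> latt N N'" if "X \<in> latt N N'" for X
    using that by (simp add: latt_iff) (metis dvd_minus_iff of_int_minus)
qed (rule latt_subset_dual)

lemma subgroup_type_of:
  assumes "mat.subspace I"
  shows "subgroup (type_of N N' I) (disc_group N N')"
proof -
  interpret L: normal "latt N N'" "dual_group N N'" by (rule normal_latt)
  have "group_hom (dual_group N N') (disc_group N N') (\<lambda>X. latt N N' #>\<^bsub>dual_group N N'\<^esub> X)"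
    unfolding disc_group_def
    by (intro group_hom.intro group_hom_axioms.intro L.r_coset_hom_Mod L.factorgroup_is_group
        L.is_group)
  moreover have "subgroup (I \<inter> dual_lattice N N') (dual_group N N')"
    using assms mat.subspace_neg
    by (intro subgroup_dual_group)
      (auto simp: dual_lattice_0 dual_lattice_add dual_lattice_minus mat.subspace_0 mat.subspace_add)
  ultimately show ?thesis
    unfolding type_of_def by (rule group_hom.subgroup_img_is_subgroup)
qed

section \<open>Characteristic functions\<close>

text \<open>Formal complex linear combinations of the elements of a finite set \<open>S\<close> are functions
  with values in the complex numbers that vanish outside \<open>S\<close>; in this way the standard basis of
  $\mathbb{C}[L'/L]$ consists of the functions \<open>basis_elt \<gamma>\<close> for cosets \<open>\<gamma>\<close>. Sums of such
  functions are pointwise.\<close>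

definition basis_elt :: "'a \<Rightarrow> 'a \<Rightarrow> complex" where
  "basis_elt x = (\<lambda>y. if y = x then 1 else 0)"

definition smult :: "complex \<Rightarrow> ('a \<Rightarrow> complex) \<Rightarrow> 'a \<Rightarrow> complex" where
  "smult t f = (\<lambda>x. t * f x)"

definition charfun :: "'a set \<Rightarrow> 'a \<Rightarrow> complex" where
  "charfun H = (\<Sum>\<gamma>\<in>H. basis_elt \<gamma>)"

section \<open>The summation over residue classes\<close>

text \<open>Non-negative representatives of the classes in $d\mathbb{Z}/m\mathbb{Z}$, where \<open>d\<close>
  divides \<open>m\<close>, and of the units modulo \<open>m\<close>.\<close>

definition multiple_reps :: "nat \<Rightarrow> nat \<Rightarrow> nat set \<Rightarrow> bool" where
  "multiple_reps d m A \<longleftrightarrow> (\<forall>a\<in>A. d dvd a) \<and> (\<forall>x. d dvd x \<longrightarrow> (\<exists>!a. a \<in> A \<and> [a = x] (mod m)))"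

definition unit_reps :: "nat \<Rightarrow> nat set \<Rightarrow> bool" where
  "unit_reps m A \<longleftrightarrow> (\<forall>a\<in>A. coprime a m) \<and> (\<forall>x. coprime x m \<longrightarrow> (\<exists>!a. a \<in> A \<and> [a = x] (mod m)))"

text \<open>The representatives of the units may be chosen independently for each exponent \<open>s\<close>.\<close>

definition rep_system :: "nat \<Rightarrow> nat \<Rightarrow> nat \<Rightarrow> nat set \<Rightarrow> nat set \<Rightarrow> (nat \<Rightarrow> nat set) \<Rightarrow> bool" where
  "rep_system p r r' A C U \<longleftrightarrow>
     multiple_reps p (p ^ r') A \<and>
     multiple_reps (p ^ (r - r' + 1)) (p ^ r) C \<and>
     (\<forall>s\<in>{0..r - r'}. unit_reps (p ^ r') (U s))"

definition cusp_sum :: "nat \<Rightarrow> nat \<Rightarrow> nat \<Rightarrow> nat set \<Rightarrow> nat set \<Rightarrow> (nat \<Rightarrow> nat set) \<Rightarrow>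
    (nat \<Rightarrow> nat \<Rightarrow> 'b::comm_monoid_add) \<Rightarrow> 'b" where
  "cusp_sum p r r' A C U F =
     (\<Sum>a\<in>A. F a 1) + (\<Sum>c\<in>C. F 1 c) + (\<Sum>s\<in>{0..r - r'}. \<Sum>u\<in>U s. F 1 (u * p ^ s))"

end

(* Writing elements of the discriminant group as (w,x,y,z), the subgroup H^2_{a,c} is the image of
   H^1_{a,c} under the swap (y,z) -> (-z,-y). If one of w, x, y, z is prime to p, then (w,x,y,z) lies
   in exactly one of the listed H^1, and in exactly one of the listed H^2, when it is isotropic, and
   in none otherwise. If all four are divisible by p, dividing them by p lowers r' by one and divides
   the number of H^1 (and of H^2) containing the element by p, as long as r' > 1; for r' = 1 these
   numbers depend on y and z only modulo p. By induction on r' both numbers agree for every element,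
   which is the relation. Conversely, any H^1 and H^2 share an element with a coordinate prime to p,
   namely a generator of the line in which the two planes meet. Evaluating a relation there shows
   that the coefficient of this H^1 is minus that of this H^2; as the pair was arbitrary, the
   relation is unique up to scalars. *)
theory Submission
  imports Defs
begin

section \<open>Counting solutions of the membership conditions\<close>

text \<open>The difficulty is \<open>t > 0\<close>: \<open>w\<close> and \<open>x\<close> live
  modulo \<open>p ^ (n + t)\<close>, but \<open>y\<close> and \<open>z\<close> only modulo
  \<open>p ^ n\<close>, so an equation such as x = p^s u y is not well defined modulo p^(n+t) when s
  < t. Writing x = p^s X and w = p^(t-s) W leaves congruences modulo \<open>p ^ n\<close> alone, in
  which \<open>u\<close> matters only modulo \<open>p ^ n\<close>; this is why each exponent s
  carries the units modulo p^r' and not modulo p^r. It is also the source of the factor p in the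
  induction: for coordinates divisible by p, the condition at level n + 1 depends on u only modulo
  p^n, so every solution has p lifts. The induction on n = r' keeps t fixed and starts at n = 1,
  since modulo p^0 units and multiples of p can no longer be told apart. There w and x need no
  reduction, because the swap does not move them.\<close>

text \<open>In coordinates $(w,x,y,z)$ and with $t = r - r'$, \<open>unit_cond\<close> describes
  $H^1_{1,up^s}$ if \<open>u\<close> is a unit or \<open>s = t\<close>, and \<open>inf_cond\<close> describes $H^1_{u,1}$. The
  branch \<open>s = Suc t\<close> stands for the first of the three sums; the second sum is the part of the
  branch \<open>s = t\<close> with \<open>p dvd u\<close>.\<close>

definition unit_cond :: "nat \<Rightarrow> nat \<Rightarrow> nat \<Rightarrow> int \<Rightarrow> int \<Rightarrow> int \<Rightarrow> int \<Rightarrow> nat \<Rightarrow> int \<Rightarrow> bool" where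
  "unit_cond p n t w x y z s u \<longleftrightarrow> (\<exists>X W. x = int p ^ s * X \<and> w = int p ^ (t - s) * W \<and>
     [X = u * y] (mod int p ^ n) \<and> [z = - (u * W)] (mod int p ^ n))"

definition inf_cond :: "nat \<Rightarrow> nat \<Rightarrow> nat \<Rightarrow> int \<Rightarrow> int \<Rightarrow> int \<Rightarrow> int \<Rightarrow> int \<Rightarrow> bool" where
  "inf_cond p n t w x y z u \<longleftrightarrow> (\<exists>W. w = int p ^ t * W \<and>
     [y = u * x] (mod int p ^ n) \<and> [W = - (u * z)] (mod int p ^ n))"

text \<open>Keeps a type from being listed twice: for \<open>s < t\<close> a multiple of
  \<open>p\<close> belongs to a larger exponent, and for \<open>s = Suc t\<close> a unit
  \<open>u\<close> would give (u : 1) = (1 : 1/u), which branch 0 already contains.\<close>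

definition branch_ok :: "nat \<Rightarrow> nat \<Rightarrow> nat \<Rightarrow> nat \<Rightarrow> bool" where
  "branch_ok p t s u \<longleftrightarrow> (s < t \<longrightarrow> \<not> p dvd u) \<and> (s = Suc t \<longrightarrow> p dvd u)"

definition branch_cond :: "nat \<Rightarrow> nat \<Rightarrow> nat \<Rightarrow> int \<Rightarrow> int \<Rightarrow> int \<Rightarrow> int \<Rightarrow> nat \<Rightarrow> nat \<Rightarrow> bool" where
  "branch_cond p n t w x y z s u \<longleftrightarrow> branch_ok p t s u \<and>
     (if s \<le> t then unit_cond p n t w x y z s (int u) else inf_cond p n t w x y z (int u))"

text \<open>Here \<open>u\<close> runs over all residues below \<open>p ^ n\<close> and not over
  chosen representatives, so that raising \<open>n\<close> only lengthens the range.\<close>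

definition sol_count :: "nat \<Rightarrow> nat \<Rightarrow> nat \<Rightarrow> int \<Rightarrow> int \<Rightarrow> int \<Rightarrow> int \<Rightarrow> nat" where
  "sol_count p n t w x y z = (\<Sum>s\<le>Suc t. card {u. u < p ^ n \<and> branch_cond p n t w x y z s u})"

lemma cong_int_dvd_transfer:
  fixes a b m d :: int
  assumes "[a = b] (mod m)" "d dvd m"
  shows "d dvd a \<longleftrightarrow> d dvd b"
  using assms cong_dvd_iff cong_dvd_modulus by blast

lemma cong_mult_cancel_pow:
  fixes q a b :: int
  assumes "q \<noteq> 0"
  shows "[q ^ s * a = q ^ s * b] (mod q ^ (s + n)) \<longleftrightarrow> [a = b] (mod q ^ n)"
  using assms by (simp add: cong_iff_dvd_diff power_add flip: right_diff_distrib)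

lemma unit_cond_cong:
  assumes "[u = u'] (mod int p ^ n)" "unit_cond p n t w x y z s u"
  shows "unit_cond p n t w x y z s u'"
proof -
  obtain X W where "x = int p ^ s * X" "w = int p ^ (t - s) * W"
    "[X = u * y] (mod int p ^ n)" "[z = - (u * W)] (mod int p ^ n)"
    using assms(2) unfolding unit_cond_def by blast
  moreover from this have "[X = u' * y] (mod int p ^ n)" "[z = - (u' * W)] (mod int p ^ n)"
    using assms(1) by (meson cong_trans cong_scalar_right cong_minus_minus_iff)+
  ultimately show ?thesis unfolding unit_cond_def by blast
qed

lemma inf_cond_cong:
  assumes "[u = u'] (mod int p ^ n)" "inf_cond p n t w x y z u"
  shows "inf_cond p n t w x y z u'"
proof -
  obtain W where "w = int p ^ t * W"
    "[y = u * x] (mod int p ^ n)" "[W = - (u * z)] (mod int p ^ n)"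
    using assms(2) unfolding inf_cond_def by blast
  moreover from this have "[y = u' * x] (mod int p ^ n)" "[W = - (u' * z)] (mod int p ^ n)"
    using assms(1) by (meson cong_trans cong_scalar_right cong_minus_minus_iff)+
  ultimately show ?thesis unfolding inf_cond_def by blast
qed

text \<open>Besides the congruences, \<open>branch_ok\<close> has to be periodic:
  \<open>1 \<le> n\<close> makes \<open>p dvd u\<close> a property of the residue of
  \<open>u\<close>.\<close>

lemma branch_cond_mod:
  assumes "1 \<le> n"
  shows "branch_cond p n t w x y z s (u mod p ^ n) \<longleftrightarrow> branch_cond p n t w x y z s u"
proof -
  have c: "[int (u mod p ^ n) = int u] (mod int p ^ n)"
    by (metis cong_int_iff cong_mod_left cong_refl of_nat_power)
  have d: "p dvd (u mod p ^ n) \<longleftrightarrow> p dvd u"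
    using assms by (simp add: dvd_mod_iff dvd_power)
  show ?thesis
    unfolding branch_cond_def branch_ok_def d
    using unit_cond_cong[OF c] unit_cond_cong[OF cong_sym[OF c]]
      inf_cond_cong[OF c] inf_cond_cong[OF cong_sym[OF c]] by auto
qed

text \<open>Supplies the factor \<open>p\<close> when the range grows from \<open>p ^ m\<close> to
  \<open>p ^ Suc m\<close> while the condition keeps the period \<open>p ^ m\<close>.\<close>

lemma card_periodic:
  fixes Q :: "nat \<Rightarrow> bool"
  assumes "\<And>u. Q (u mod m) \<longleftrightarrow> Q u"
  shows "card {u. u < k * m \<and> Q u} = k * card {u. u < m \<and> Q u}"
proof (induction k)
  case (Suc k)
  have Q: "Q (k * m + v) \<longleftrightarrow> Q v" if "v < m" for v
    using assms[of "k * m + v"] that by simp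
  have "{u. u < Suc k * m \<and> Q u} = {u. u < k * m \<and> Q u} \<union> (\<lambda>u. k * m + u) ` {u. u < m \<and> Q u}"
  proof (intro equalityI subsetI)
    fix u assume u: "u \<in> {u. u < Suc k * m \<and> Q u}"
    show "u \<in> {u. u < k * m \<and> Q u} \<union> (\<lambda>u. k * m + u) ` {u. u < m \<and> Q u}"
    proof (cases "u < k * m")
      case False
      then have e: "u = k * m + (u - k * m)" "u - k * m < m" using u by auto
      then have "Q (u - k * m)" using Q[of "u - k * m"] u by simp
      with e show ?thesis by blast
    qed (use u in auto)
  next
    fix u assume "u \<in> {u. u < k * m \<and> Q u} \<union> (\<lambda>u. k * m + u) ` {u. u < m \<and> Q u}"
    then show "u \<in> {u. u < Suc k * m \<and> Q u}"
      using Q by auto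
  qed
  moreover have "card ((\<lambda>u. k * m + u) ` {u. u < m \<and> Q u}) = card {u. u < m \<and> Q u}"
    by (intro card_image) (auto simp: inj_on_def)
  moreover have "{u. u < k * m \<and> Q u} \<inter> (\<lambda>u. k * m + u) ` {u. u < m \<and> Q u} = {}" by auto
  ultimately show ?case using Suc by (simp add: card_Un_disjoint)
qed simp

text \<open>This is the p-adic valuation capped at \<open>t\<close>. The cap covers
  \<open>x = 0\<close> and is the reason why \<open>s = t\<close> comes without a unit
  condition.\<close>

lemma extract_power:
  fixes p :: int
  shows "\<exists>s\<le>t. \<exists>X. x = p ^ s * X \<and> (s = t \<or> \<not> p dvd X)"
proof (induction t)
  case (Suc t)
  then obtain s X where sX: "s \<le> t" "x = p ^ s * X" "s = t \<or> \<not> p dvd X" by blast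
  show ?case
  proof (cases "p dvd X")
    case True
    then obtain Y where "X = p * Y" by auto
    with sX True show ?thesis by (intro exI[of _ "Suc t"]) auto
  next
    case False
    with sX show ?thesis using le_SucI by blast
  qed
qed auto

section \<open>Units modulo powers of a fixed prime, and isotropy of the branches\<close>

locale prime_pair =
  fixes p n t :: nat
  assumes prime_p: "prime p" and n_ge: "1 \<le> n"
begin

lemma prime_int: "prime (int p)"
  using prime_p by simp

lemma p_nz: "int p \<noteq> 0"
  using prime_p by auto

lemma dvd_pow: "int p dvd int p ^ n"
  using n_ge by simp

lemma p_dvd_mult: "int p dvd a * b \<longleftrightarrow> int p dvd a \<or> int p dvd b"
  using prime_int by (rule prime_dvd_mult_iff)

lemma cong_p_dvd: "[a = b] (mod int p ^ n) \<Longrightarrow> int p dvd a \<longleftrightarrow> int p dvd b"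
  using cong_int_dvd_transfer dvd_pow by blast

lemma coprime_pow_iff: "coprime u (int p ^ k) \<longleftrightarrow> k = 0 \<or> \<not> int p dvd u"
  using prime_int by (metis coprime_commute coprime_power_right_iff prime_imp_coprime_int
    coprime_1_right power_0 not_prime_unit coprime_common_divisor dvd_refl)

lemma inverse_mod:
  assumes "\<not> int p dvd u"
  obtains v where "[u * v = 1] (mod int p ^ k)" "\<not> int p dvd v"
proof -
  \<comment> \<open>Inverting modulo one power more makes \<open>v\<close> prime to \<open>p\<close>
    even for \<open>k = 0\<close>.\<close>
  have "coprime u (int p ^ Suc k)"
    using assms coprime_pow_iff by blast
  then obtain v where v: "[u * v = 1] (mod int p ^ Suc k)"
    using cong_solve_coprime_int by blast
  then have "int p dvd u * v \<longleftrightarrow> int p dvd 1"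
    by (rule cong_int_dvd_transfer) simp
  then have "\<not> int p dvd v"
    using prime_int not_prime_unit by (auto)
  moreover have "[u * v = 1] (mod int p ^ k)"
    using v by (rule cong_dvd_modulus) (simp add: le_imp_power_dvd)
  ultimately show ?thesis using that by blast
qed

lemma unit_condI_nat:
  assumes "unit_cond p n t w x y z s u" "s \<le> t" "s = t \<or> \<not> int p dvd u"
  obtains v where "v < p ^ n" "branch_cond p n t w x y z s v"
proof
  define v where "v = nat (u mod int p ^ n)"
  have pos: "int p ^ n > 0" using prime_p prime_gt_0_nat by simp
  have v: "int v = u mod int p ^ n" using pos_mod_sign[OF pos, of u] by (simp add: v_def)
  show "v < p ^ n" using pos_mod_bound[OF pos, of u] v by (metis of_nat_less_iff of_nat_power)
  have c: "[u = int v] (mod int p ^ n)" by (simp add: v)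
  have "p dvd v \<longleftrightarrow> int p dvd u" using cong_p_dvd[OF c] by simp
  then show "branch_cond p n t w x y z s v"
    using assms unit_cond_cong[OF c] by (auto simp: branch_cond_def branch_ok_def)
qed

lemma inf_condI_nat:
  assumes "inf_cond p n t w x y z u" "int p dvd u"
  obtains v where "v < p ^ n" "branch_cond p n t w x y z (Suc t) v"
proof
  define v where "v = nat (u mod int p ^ n)"
  have pos: "int p ^ n > 0" using prime_p prime_gt_0_nat by simp
  have v: "int v = u mod int p ^ n" using pos_mod_sign[OF pos, of u] by (simp add: v_def)
  show "v < p ^ n" using pos_mod_bound[OF pos, of u] v by (metis of_nat_less_iff of_nat_power)
  have c: "[u = int v] (mod int p ^ n)" by (simp add: v)
  have "p dvd v \<longleftrightarrow> int p dvd u" using cong_p_dvd[OF c] by simp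
  then show "branch_cond p n t w x y z (Suc t) v"
    using assms inf_cond_cong[OF c] by (auto simp: branch_cond_def branch_ok_def)
qed

text \<open>In each branch the two congruences enter with opposite signs and \<open>u\<close>
  cancels. The number on the right is q(w,x,y,z) = wx/N + yz/N' multiplied by N = p^(n+t), so the
  conclusion says that q vanishes modulo 1.\<close>

lemma branch_cond_isotropic:
  assumes "branch_cond p n t w x y z s u"
  shows "int p ^ (n + t) dvd x * w + int p ^ t * (y * z)"
proof (cases "s \<le> t")
  case True
  then obtain X W where *: "x = int p ^ s * X" "w = int p ^ (t - s) * W"
    "[X = int u * y] (mod int p ^ n)" "[z = - (int u * W)] (mod int p ^ n)"
    using assms unfolding branch_cond_def unit_cond_def by auto
  have "[X * W + y * z = int u * y * W + y * (- (int u * W))] (mod int p ^ n)"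
    using * by (intro cong_add cong_mult cong_refl)
  then have "int p ^ n dvd X * W + y * z"
    by (simp add: cong_iff_dvd_diff)
  moreover have "x * w = int p ^ t * (X * W)"
    using True unfolding * by (simp flip: power_add)
  ultimately show ?thesis
    by (simp add: power_add mult.commute[of _ "int p ^ t"] flip: distrib_left)
next
  case False
  then obtain W where *: "w = int p ^ t * W"
    "[y = int u * x] (mod int p ^ n)" "[W = - (int u * z)] (mod int p ^ n)"
    using assms unfolding branch_cond_def inf_cond_def by auto
  have "[x * W + y * z = x * (- (int u * z)) + int u * x * z] (mod int p ^ n)"
    using * by (intro cong_add cong_mult cong_refl)
  then have "int p ^ n dvd x * W + y * z"
    by (simp add: cong_iff_dvd_diff)
  moreover have "x * w + int p ^ t * (y * z) = int p ^ t * (x * W + y * z)"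
    unfolding *(1) by (simp add: algebra_simps)
  ultimately show ?thesis
    by (simp add: power_add mult.commute[of _ "int p ^ t"])
qed

section \<open>A primitive isotropic quadruple lies in exactly one branch\<close>

lemma cong_nat_eq:
  assumes "[int u = int u'] (mod int p ^ n)" "u < p ^ n" "u' < p ^ n"
  shows "u = u'"
  using assms by (metis cong_int_iff cong_less_modulus_unique_nat of_nat_power)

lemma cong_cancel_either:
  assumes "[u * a = u' * a] (mod int p ^ n)" "[u * b = u' * b] (mod int p ^ n)"
    and "\<not> int p dvd a \<or> \<not> int p dvd b"
  shows "[u = u'] (mod int p ^ n)"
  using assms coprime_pow_iff by (metis cong_mult_rcancel)

text \<open>Lying in two different branches forces \<open>p\<close> to divide all four coordinates.
  Within one branch, the pair that \<open>u\<close> multiplies (\<open>y\<close> and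
  \<open>W\<close>, or \<open>x\<close> and \<open>z\<close> for \<open>s = Suc t\<close>) contains
  a unit, since otherwise all four would again be divisible; cancelling it determines
  \<open>u\<close> modulo \<open>p ^ n\<close>.\<close>

lemma branch_unique:
  assumes prim: "\<not> (int p dvd w \<and> int p dvd x \<and> int p dvd y \<and> int p dvd z)"
    and 1: "branch_cond p n t w x y z s u" "s \<le> Suc t" "u < p ^ n"
    and 2: "branch_cond p n t w x y z s' u'" "s' \<le> Suc t" "u' < p ^ n"
    and le: "s \<le> s'"
  shows "s = s' \<and> u = u'"
proof (cases "s' \<le> t")
  case True
  with le have st: "s \<le> t" by simp
  obtain X W where a: "x = int p ^ s * X" "w = int p ^ (t - s) * W"
    "[X = int u * y] (mod int p ^ n)" "[z = - (int u * W)] (mod int p ^ n)"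
    using 1 st unfolding branch_cond_def unit_cond_def by auto
  obtain X' W' where b: "x = int p ^ s' * X'" "w = int p ^ (t - s') * W'"
    "[X' = int u' * y] (mod int p ^ n)" "[z = - (int u' * W')] (mod int p ^ n)"
    using 2 True unfolding branch_cond_def unit_cond_def by auto
  show ?thesis
  proof (cases "s = s'")
    case eq: True
    then have [simp]: "X' = X" "W' = W" using a(1,2) b(1,2) p_nz by auto
    have "[int u * y = int u' * y] (mod int p ^ n)"
      using a(3) b(3) by (metis \<open>X' = X\<close> cong_sym cong_trans)
    moreover have "[int u * W = int u' * W] (mod int p ^ n)"
      using a(4) b(4) by (metis \<open>W' = W\<close> cong_sym cong_trans cong_minus_minus_iff)
    moreover have "\<not> int p dvd y \<or> \<not> int p dvd W"
      using prim a cong_p_dvd[OF a(3)] cong_p_dvd[OF a(4)] by auto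
    ultimately show ?thesis using cong_cancel_either cong_nat_eq 1 2 eq by blast
  next
    case False
    with le have lt: "s < s'" by simp
    obtain d where d: "s' = s + Suc d" using lt less_iff_Suc_add by auto
    have "X = int p * (int p ^ d * X')" using a(1) b(1) p_nz unfolding d by (simp add: power_add)
    then have X: "int p dvd X" by simp
    have "t - s = t - s' + Suc d" using True d by simp
    then have "W' = int p * (int p ^ d * W)" using a(2) b(2) p_nz by (simp add: power_add)
    then have W: "int p dvd W'" by simp
    \<comment> \<open>Since \<open>s < s' \<le> t\<close>, the smaller exponent is below
      \<open>t\<close>, and \<open>branch_ok\<close> makes \<open>u\<close> a unit.\<close>
    have "\<not> int p dvd int u"
      using 1(1) lt True by (auto simp: branch_cond_def branch_ok_def)
    then have "int p dvd y" using cong_p_dvd[OF a(3)] X p_dvd_mult by blast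
    moreover have "int p dvd z" using cong_p_dvd[OF b(4)] W by simp
    moreover have "int p dvd x" using X a(1) by simp
    moreover have "int p dvd w" using W b(2) by simp
    ultimately show ?thesis using prim by blast
  qed
next
  case False
  with 2 have s': "s' = Suc t" by simp
  obtain W' where b: "w = int p ^ t * W'"
    "[y = int u' * x] (mod int p ^ n)" "[W' = - (int u' * z)] (mod int p ^ n)"
    using 2 s' unfolding branch_cond_def inf_cond_def by auto
  have pu: "int p dvd int u'" using 2 s' by (auto simp: branch_cond_def branch_ok_def)
  have py: "int p dvd y" using cong_p_dvd[OF b(2)] pu by simp
  have pW: "int p dvd W'" using cong_p_dvd[OF b(3)] pu by simp
  then have pw: "int p dvd w" using b by simp
  show ?thesis
  proof (cases "s \<le> t")
    case st: True
    obtain X W where a: "x = int p ^ s * X" "w = int p ^ (t - s) * W"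
      "[X = int u * y] (mod int p ^ n)" "[z = - (int u * W)] (mod int p ^ n)"
      using 1 st unfolding branch_cond_def unit_cond_def by auto
    \<comment> \<open>Comparing the two factorizations of \<open>w\<close> carries the divisibility
      of \<open>W'\<close> over to \<open>W\<close>.\<close>
    have "int p ^ t = int p ^ (t - s) * int p ^ s" using st by (simp flip: power_add)
    then have "W = int p ^ s * W'" using a(2) b(1) p_nz by simp
    then have "int p dvd W" using pW by simp
    then have "int p dvd z" using cong_p_dvd[OF a(4)] by simp
    moreover have "int p dvd x" using cong_p_dvd[OF a(3)] a(1) py by simp
    ultimately show ?thesis using prim py pw by blast
  next
    case False
    with 1 have s: "s = Suc t" by simp
    obtain W where a: "w = int p ^ t * W"
      "[y = int u * x] (mod int p ^ n)" "[W = - (int u * z)] (mod int p ^ n)"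
      using 1 s unfolding branch_cond_def inf_cond_def by auto
    have [simp]: "W' = W" using a(1) b(1) p_nz by auto
    have "[int u * x = int u' * x] (mod int p ^ n)"
      using a(2) b(2) by (metis cong_sym cong_trans)
    moreover have "[int u * z = int u' * z] (mod int p ^ n)"
      using a(3) b(3) by (metis \<open>W' = W\<close> cong_sym cong_trans cong_minus_minus_iff)
    moreover have "\<not> int p dvd x \<or> \<not> int p dvd z"
      using prim py pw by auto
    ultimately show ?thesis using cong_cancel_either cong_nat_eq 1 2 s s' by blast
  qed
qed

text \<open>A unit coordinate can be divided by, which dictates both branch and parameter: u = X/y
  if \<open>y\<close> is a unit; u = -z/W or, in the last branch, u = -W/z if \<open>z\<close> is; u
  = y/x in the last branch if \<open>x\<close> is; u = -z/w at \<open>s = t\<close> if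
  \<open>w\<close> is. Isotropy supplies the second congruence each time.\<close>

lemma branch_exists:
  assumes prim: "\<not> (int p dvd w \<and> int p dvd x \<and> int p dvd y \<and> int p dvd z)"
    and iso: "int p ^ (n + t) dvd x * w + int p ^ t * (y * z)"
  shows "\<exists>s\<le>Suc t. \<exists>u<p ^ n. branch_cond p n t w x y z s u"
proof -
  have iso1: "[X * W = - (y * z)] (mod int p ^ n)"
    if "x = int p ^ s * X" "w = int p ^ (t - s) * W" "s \<le> t" for s X W
  proof -
    have "int p ^ t = int p ^ s * int p ^ (t - s)" using that by (simp flip: power_add)
    then have "x * w = int p ^ t * (X * W)" using that by simp
    with iso have "int p ^ t * int p ^ n dvd int p ^ t * (X * W + y * z)"
      by (simp add: power_add distrib_left mult.commute)
    then show ?thesis using p_nz by (simp add: cong_iff_dvd_diff)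
  qed
  have ptxw: "int p ^ t dvd x * w"
  proof -
    have "int p ^ t dvd x * w + int p ^ t * (y * z)"
      using iso by (metis dvd_trans dvd_triv_right power_add)
    then show ?thesis by (metis dvd_add_left_iff dvd_triv_left)
  qed
  \<comment> \<open>Isotropy gives \<open>int p ^ t dvd x * w\<close>; as \<open>X\<close> is prime
    to \<open>p\<close> unless \<open>s = t\<close>, the part of this power not found in
    \<open>x\<close> must divide \<open>w\<close>.\<close>
  have xw: "\<exists>W. w = int p ^ (t - s) * W"
    if "x = int p ^ s * X" "s = t \<or> \<not> int p dvd X" "s \<le> t" for s X
  proof (cases "s = t")
    case False
    have "int p ^ t = int p ^ s * int p ^ (t - s)" using that by (simp flip: power_add)
    then have "int p ^ (t - s) dvd X * w" using ptxw that p_nz by (simp add: mult.assoc)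
    moreover have "coprime X (int p ^ (t - s))" using that False coprime_pow_iff by blast
    then have "coprime (int p ^ (t - s)) X" by (simp add: coprime_commute)
    ultimately have "int p ^ (t - s) dvd w" by (simp only: coprime_dvd_mult_right_iff)
    then show ?thesis by (simp add: dvd_def)
  qed simp
  have wx: "\<exists>X. x = int p ^ s * X"
    if "w = int p ^ (t - s) * W" "s = 0 \<or> \<not> int p dvd W" "s \<le> t" for s W
  proof (cases "s = 0")
    case False
    have "int p ^ t = int p ^ (t - s) * int p ^ s" using that by (simp flip: power_add)
    then have "int p ^ s dvd x * W" using ptxw that p_nz by (simp add: mult.left_commute)
    moreover have "coprime W (int p ^ s)" using that False coprime_pow_iff by blast
    then have "coprime (int p ^ s) W" by (simp add: coprime_commute)
    ultimately have "int p ^ s dvd x" by (simp only: coprime_dvd_mult_left_iff)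
    then show ?thesis by (simp add: dvd_def)
  qed simp
  consider "\<not> int p dvd y" | "\<not> int p dvd z" | "int p dvd y" "\<not> int p dvd x"
    | "int p dvd z" "\<not> int p dvd w" using prim by blast
  then show ?thesis
  proof cases
    case 1
    obtain s X where sX: "s \<le> t" "x = int p ^ s * X" "s = t \<or> \<not> int p dvd X"
      using extract_power by meson
    obtain W where W: "w = int p ^ (t - s) * W" using xw sX by blast
    obtain v where v: "[y * v = 1] (mod int p ^ n)" "\<not> int p dvd v" using inverse_mod 1 by blast
    have "[X = (y * v) * X] (mod int p ^ n)" using v(1) by (metis cong_scalar_right cong_sym mult_1)
    then have X: "[X = (X * v) * y] (mod int p ^ n)" by (simp add: mult_ac)
    have "[v * - (X * W) = v * (y * z)] (mod int p ^ n)"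
      using iso1[OF sX(2) W sX(1)] by (metis cong_minus_minus_iff cong_scalar_left minus_minus)
    moreover have "[v * (y * z) = z] (mod int p ^ n)"
      using cong_scalar_right[OF v(1), of z] by (simp add: mult_ac)
    ultimately have "[z = - ((X * v) * W)] (mod int p ^ n)"
      by (metis (no_types, lifting) cong_sym cong_trans mult.assoc mult.commute mult_minus_right)
    with X W sX have "unit_cond p n t w x y z s (X * v)" unfolding unit_cond_def by blast
    then show ?thesis using sX v p_dvd_mult unit_condI_nat
      by (metis le_Suc_eq)
  next
    case 2
    \<comment> \<open>The parameter will be -z/W, so the exponent is read off from \<open>w\<close>
      and not from \<open>x\<close>.\<close>
    obtain k W where kW: "k \<le> t" "w = int p ^ k * W" "k = t \<or> \<not> int p dvd W"
      using extract_power by meson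
    define s where "s = t - k"
    have s: "w = int p ^ (t - s) * W" "s = 0 \<or> \<not> int p dvd W" "s \<le> t" using kW by (auto simp: s_def)
    obtain X where X: "x = int p ^ s * X" using wx s by blast
    have iso': "[X * W = - (y * z)] (mod int p ^ n)" using iso1 X s by blast
    show ?thesis
    proof (cases "int p dvd W")
      case False
      obtain v where v: "[W * v = 1] (mod int p ^ n)" "\<not> int p dvd v" using inverse_mod False by blast
      have "[X * (W * v) = - (y * z) * v] (mod int p ^ n)"
        using cong_scalar_right[OF iso', of v] by (simp add: mult_ac)
      moreover have "[X * (W * v) = X] (mod int p ^ n)" using cong_scalar_left[OF v(1), of X] by simp
      ultimately have "[X = (- z * v) * y] (mod int p ^ n)"
        by (metis (no_types, lifting) cong_sym cong_trans mult.commute mult.left_commute mult_minus_left)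
      moreover have "[z = - ((- z * v) * W)] (mod int p ^ n)"
        using cong_scalar_left[OF v(1), of z] by (simp add: mult_ac cong_sym)
      ultimately have "unit_cond p n t w x y z s (- z * v)" using X s unfolding unit_cond_def by blast
      moreover have "\<not> int p dvd - z * v" using v 2 p_dvd_mult by simp
      ultimately show ?thesis using s unit_condI_nat by (metis le_Suc_eq)
    next
      case True
      then have [simp]: "s = 0" using s by simp
      obtain v where v: "[z * v = 1] (mod int p ^ n)" "\<not> int p dvd v" using inverse_mod 2 by blast
      have "[- (x * W) * v = y * (z * v)] (mod int p ^ n)"
        using cong_scalar_right[OF iso', of "- v"] X by (simp add: mult_ac)
      moreover have "[y * (z * v) = y] (mod int p ^ n)" using cong_scalar_left[OF v(1), of y] by simp
      ultimately have "[y = (- W * v) * x] (mod int p ^ n)"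
        by (metis (no_types, lifting) cong_sym cong_trans mult.commute mult.left_commute mult_minus_left)
      moreover have "[W = - ((- W * v) * z)] (mod int p ^ n)"
        using cong_scalar_left[OF v(1), of W] by (simp add: mult_ac cong_sym)
      ultimately have "inf_cond p n t w x y z (- W * v)" using s unfolding inf_cond_def by auto
      then show ?thesis using True inf_condI_nat by (metis dvd_minus_iff dvd_mult2 le_refl)
    qed
  next
    case 3
    obtain W where W: "w = int p ^ t * W" using xw[of 0 x] 3 by auto
    obtain v where v: "[x * v = 1] (mod int p ^ n)" "\<not> int p dvd v" using inverse_mod 3 by blast
    have iso': "[x * W = - (y * z)] (mod int p ^ n)" using iso1[of 0 x W] W by simp
    have "[y = (y * v) * x] (mod int p ^ n)"
      using cong_scalar_left[OF v(1), of y] by (simp add: mult_ac cong_sym)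
    moreover have "[W * (x * v) = - ((y * v) * z)] (mod int p ^ n)"
      using cong_scalar_right[OF iso', of v] by (simp add: mult_ac)
    moreover have "[W * (x * v) = W] (mod int p ^ n)"
      using cong_scalar_left[OF v(1), of W] by simp
    ultimately have "inf_cond p n t w x y z (y * v)" using W unfolding inf_cond_def
      by (metis cong_sym cong_trans)
    then show ?thesis using 3 inf_condI_nat by (metis dvd_mult2 le_refl)
  next
    case 4
    obtain X where X: "x = int p ^ t * X" using wx[of t w] 4 by auto
    obtain v where v: "[w * v = 1] (mod int p ^ n)" "\<not> int p dvd v" using inverse_mod 4 by blast
    have iso': "[X * w = - (y * z)] (mod int p ^ n)" using iso1[of t X w] X by simp
    have "[X * (w * v) = (- z * v) * y] (mod int p ^ n)"
      using cong_scalar_right[OF iso', of v] by (simp add: mult_ac)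
    moreover have "[X * (w * v) = X] (mod int p ^ n)"
      using cong_scalar_left[OF v(1), of X] by simp
    moreover have "[z = - ((- z * v) * w)] (mod int p ^ n)"
      using cong_scalar_left[OF v(1), of z] by (simp add: mult_ac cong_sym)
    ultimately have "unit_cond p n t w x y z t (- z * v)" using X unfolding unit_cond_def
      by (metis (no_types, lifting) cong_sym cong_trans diff_self_eq_0 mult_1 power_0)
    then show ?thesis using unit_condI_nat by (metis le_Suc_eq le_refl)
  qed
qed

lemma sol_count_alt:
  "sol_count p n t w x y z =
     card {(s, u). s \<le> Suc t \<and> u < p ^ n \<and> branch_cond p n t w x y z s u}"
proof -
  have "{(s, u). s \<le> Suc t \<and> u < p ^ n \<and> branch_cond p n t w x y z s u} =
    (SIGMA s:{..Suc t}. {u. u < p ^ n \<and> branch_cond p n t w x y z s u})" by auto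
  then show ?thesis unfolding sol_count_def by (simp del: sum.atMost_Suc)
qed

text \<open>The right-hand side does not change under (y,z) -> (-z,-y), which makes the symmetry of
  the count immediate for primitive quadruples.\<close>

lemma sol_count_primitive:
  assumes "\<not> (int p dvd w \<and> int p dvd x \<and> int p dvd y \<and> int p dvd z)"
  shows "sol_count p n t w x y z =
    (if int p ^ (n + t) dvd x * w + int p ^ t * (y * z) then 1 else 0)"
proof (cases "int p ^ (n + t) dvd x * w + int p ^ t * (y * z)")
  case True
  obtain s u where su: "s \<le> Suc t" "u < p ^ n" "branch_cond p n t w x y z s u"
    using branch_exists[OF assms True] by blast
  have "s' = s \<and> u' = u" if "s' \<le> Suc t" "u' < p ^ n" "branch_cond p n t w x y z s' u'" for s' u'
    using branch_unique[OF assms] su that by (metis nle_le)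
  with su have "{(s, u). s \<le> Suc t \<and> u < p ^ n \<and> branch_cond p n t w x y z s u} = {(s, u)}"
    by blast
  then show ?thesis using True by (simp add: sol_count_alt)
next
  case False
  then have "{(s, u). s \<le> Suc t \<and> u < p ^ n \<and> branch_cond p n t w x y z s u} = {}"
    using branch_cond_isotropic by blast
  then show ?thesis unfolding sol_count_alt if_not_P[OF False] by (simp only: card.empty)
qed

end

section \<open>Reduction modulo a smaller power and the symmetry of the count\<close>

text \<open>Membership in $H^1_{a,c}$. The last congruence is multiplied by $p^t$, which encodes the
  divisibility of $ck$ by $p^t$ without a division.\<close>

definition type_cond ::
    "nat \<Rightarrow> nat \<Rightarrow> nat \<Rightarrow> int \<Rightarrow> int \<Rightarrow> int \<Rightarrow> int \<Rightarrow> int \<Rightarrow> int \<Rightarrow> bool" where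
  "type_cond p n t a c w x y z \<longleftrightarrow> (\<exists>j k. [y = a * j] (mod int p ^ n) \<and>
     [x = c * j] (mod int p ^ (n + t)) \<and> [w = a * k] (mod int p ^ (n + t)) \<and>
     [int p ^ t * z = - (c * k)] (mod int p ^ (n + t)))"

definition index_set :: "nat \<Rightarrow> nat \<Rightarrow> nat set \<Rightarrow> nat set \<Rightarrow> (nat \<Rightarrow> nat set) \<Rightarrow> (nat \<times> nat) set" where
  "index_set p t A C U = (\<lambda>a. (a, 1)) ` A \<union> (\<lambda>c. (1, c)) ` C \<union>
     (\<Union>s\<in>{0..t}. (\<lambda>u. (1, u * p ^ s)) ` U s)"

text \<open>Reduction trades arbitrary representatives for standard residues; \<open>d dvd m\<close>
  ensures that it preserves divisibility by \<open>d\<close>.\<close>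

lemma multiple_reps_mod_bij:
  assumes "multiple_reps d m A" "d dvd m" "0 < m"
  shows "bij_betw (\<lambda>a. a mod m) A {x. x < m \<and> d dvd x}"
proof (rule bij_betwI')
  fix a b assume "a \<in> A" "b \<in> A"
  then show "(a mod m = b mod m) \<longleftrightarrow> a = b"
    using assms(1) unfolding multiple_reps_def cong_def by metis
next
  fix a assume "a \<in> A"
  then show "a mod m \<in> {x. x < m \<and> d dvd x}"
    using assms unfolding multiple_reps_def by (simp add: dvd_mod)
next
  fix x assume "x \<in> {x. x < m \<and> d dvd x}"
  then show "\<exists>a\<in>A. x = a mod m"
    using assms(1) unfolding multiple_reps_def cong_def by (metis mem_Collect_eq mod_less)
qed

lemma unit_reps_mod_bij:
  assumes "unit_reps m A" "0 < m"
  shows "bij_betw (\<lambda>a. a mod m) A {x. x < m \<and> coprime x m}"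
proof (rule bij_betwI')
  fix a b assume "a \<in> A" "b \<in> A"
  then show "(a mod m = b mod m) \<longleftrightarrow> a = b"
    using assms(1) unfolding unit_reps_def cong_def by metis
next
  fix a assume "a \<in> A"
  then show "a mod m \<in> {x. x < m \<and> coprime x m}"
    using assms unfolding unit_reps_def by (simp add: coprime_mod_left_iff)
next
  fix x assume "x \<in> {x. x < m \<and> coprime x m}"
  then show "\<exists>a\<in>A. x = a mod m"
    using assms(1) unfolding unit_reps_def cong_def by (metis mem_Collect_eq mod_less)
qed

lemma card_periodic_bij:
  assumes "bij_betw (\<lambda>a. a mod m) A S" "\<And>a. Q (a mod m) \<longleftrightarrow> Q a"
  shows "card {a \<in> A. Q a} = card {a \<in> S. Q a}"
proof -
  have "bij_betw (\<lambda>a. a mod m) {a \<in> A. Q a} {a \<in> S. Q a}"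
    using assms unfolding bij_betw_def by (auto simp: inj_on_def image_iff)
  then show ?thesis by (rule bij_betw_same_card)
qed

section \<open>Dividing all four coordinates by p\<close>

context prime_pair
begin

text \<open>Dividing by \<open>p\<close> requires \<open>p\<close> to divide \<open>X\<close> and
  \<open>W\<close>. For \<open>X\<close> this follows from its congruence. For \<open>W\<close> it
  holds at \<open>s = t\<close> because there W = pw, and otherwise because \<open>u\<close> is a
  unit and uW is congruent to -pz.\<close>

lemma unit_cond_mult_p:
  "unit_cond p (Suc m) t (int p * w) (int p * x) (int p * y) (int p * z) s u
     \<longleftrightarrow> unit_cond p m t w x y z s u" if "1 \<le> m" "s \<le> t" "s = t \<or> \<not> int p dvd u"
proof
  assume "unit_cond p m t w x y z s u"
  then obtain X W where *: "x = int p ^ s * X" "w = int p ^ (t - s) * W"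
    "[X = u * y] (mod int p ^ m)" "[z = - (u * W)] (mod int p ^ m)"
    unfolding unit_cond_def by blast
  have "[int p * X = int p * (u * y)] (mod int p ^ Suc m)"
     "[int p * z = int p * (- (u * W))] (mod int p ^ Suc m)"
    using *(3,4) cong_mult_cancel_pow[OF p_nz, of 1 _ _ m] by (simp_all del: mult_minus_right)
  then show "unit_cond p (Suc m) t (int p * w) (int p * x) (int p * y) (int p * z) s u"
    unfolding unit_cond_def using *
    by (intro exI[of _ "int p * X"] exI[of _ "int p * W"]) (simp add: mult_ac)
next
  assume "unit_cond p (Suc m) t (int p * w) (int p * x) (int p * y) (int p * z) s u"
  then obtain X W where *: "int p * x = int p ^ s * X" "int p * w = int p ^ (t - s) * W"
    "[X = u * (int p * y)] (mod int p ^ Suc m)" "[int p * z = - (u * W)] (mod int p ^ Suc m)"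
    unfolding unit_cond_def by blast
  have "int p dvd X"
    using cong_int_dvd_transfer[OF *(3), of "int p"] by simp
  then obtain X' where X: "X = int p * X'" by auto
  have "int p dvd W"
  proof (cases "s = t")
    case True
    then show ?thesis using * by (metis dvd_triv_left diff_self_eq_0 mult_1 power_0)
  next
    case False
    have "int p dvd - (u * W)"
      using cong_int_dvd_transfer[OF *(4), of "int p"] by simp
    then show ?thesis using False that p_dvd_mult by simp
  qed
  then obtain W' where W: "W = int p * W'" by auto
  have "[int p ^ 1 * X' = int p ^ 1 * (u * y)] (mod int p ^ (1 + m))"
    "[int p ^ 1 * z = int p ^ 1 * (- (u * W'))] (mod int p ^ (1 + m))"
    using *(3,4) unfolding X W by (simp_all add: mult_ac)
  then have "[X' = u * y] (mod int p ^ m)" "[z = - (u * W')] (mod int p ^ m)"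
    using p_nz cong_mult_cancel_pow by blast+
  moreover have "int p * x = int p * (int p ^ s * X')" "int p * w = int p * (int p ^ (t - s) * W')"
    using * unfolding X W by (simp_all add: mult_ac)
  ultimately show "unit_cond p m t w x y z s u"
    unfolding unit_cond_def using p_nz by auto
qed

lemma inf_cond_mult_p:
  "inf_cond p (Suc m) t (int p * w) (int p * x) (int p * y) (int p * z) u
     \<longleftrightarrow> inf_cond p m t w x y z u"
proof
  assume "inf_cond p m t w x y z u"
  then obtain W where *: "w = int p ^ t * W"
    "[y = u * x] (mod int p ^ m)" "[W = - (u * z)] (mod int p ^ m)"
    unfolding inf_cond_def by blast
  have "[int p * y = int p * (u * x)] (mod int p ^ Suc m)"
     "[int p * W = int p * (- (u * z))] (mod int p ^ Suc m)"
    using *(2,3) cong_mult_cancel_pow[OF p_nz, of 1 _ _ m] by (simp_all del: mult_minus_right)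
  then show "inf_cond p (Suc m) t (int p * w) (int p * x) (int p * y) (int p * z) u"
    unfolding inf_cond_def using *
    by (intro exI[of _ "int p * W"]) (simp add: mult_ac)
next
  assume "inf_cond p (Suc m) t (int p * w) (int p * x) (int p * y) (int p * z) u"
  then obtain W where *: "int p * w = int p ^ t * W"
    "[int p * y = u * (int p * x)] (mod int p ^ Suc m)" "[W = - (u * (int p * z))] (mod int p ^ Suc m)"
    unfolding inf_cond_def by blast
  have "int p dvd W"
    using cong_int_dvd_transfer[OF *(3), of "int p"] by simp
  then obtain W' where W: "W = int p * W'" by auto
  have "[int p ^ 1 * y = int p ^ 1 * (u * x)] (mod int p ^ (1 + m))"
    "[int p ^ 1 * W' = int p ^ 1 * (- (u * z))] (mod int p ^ (1 + m))"
    using *(2,3) unfolding W by (simp_all add: mult_ac)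
  then have "[y = u * x] (mod int p ^ m)" "[W' = - (u * z)] (mod int p ^ m)"
    using p_nz cong_mult_cancel_pow by blast+
  moreover have "int p * w = int p * (int p ^ t * W')"
    using * unfolding W by (simp_all add: mult_ac)
  ultimately show "inf_cond p m t w x y z u"
    unfolding inf_cond_def using p_nz by auto
qed

text \<open>After the division the condition has period \<open>p ^ m\<close> in \<open>u\<close>,
  while \<open>u\<close> ranges below \<open>p ^ Suc m\<close>. The hypothesis
  \<open>1 \<le> m\<close> makes the unit condition on \<open>u\<close> share this period.\<close>

lemma sol_count_mult_p:
  assumes "1 \<le> m"
  shows "sol_count p (Suc m) t (int p * w) (int p * x) (int p * y) (int p * z) =
    p * sol_count p m t w x y z"
proof -
  have *: "branch_cond p (Suc m) t (int p * w) (int p * x) (int p * y) (int p * z) s u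
     \<longleftrightarrow> branch_cond p m t w x y z s u" if "s \<le> Suc t" for s u
    using unit_cond_mult_p[OF assms, of s "int u" w x y z] inf_cond_mult_p[of m w x y z "int u"] that
    by (auto simp: branch_cond_def branch_ok_def)
  have "card {u. u < p ^ Suc m \<and> branch_cond p (Suc m) t (int p * w) (int p * x) (int p * y) (int p * z) s u}
    = p * card {u. u < p ^ m \<and> branch_cond p m t w x y z s u}" if "s \<le> Suc t" for s
    using card_periodic[of "branch_cond p m t w x y z s" "p ^ m" p] branch_cond_mod[OF assms]
      *[OF that] by simp
  then show ?thesis
    unfolding sol_count_def sum_distrib_left by (intro sum.cong) auto
qed

end

section \<open>Symmetry of the count under the swap\<close>

lemma cong_minus_scalar_left:
  fixes a b u m :: int
  assumes "[a = b] (mod m)"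
  shows "[- (u * a) = - (u * b)] (mod m)"
  using assms by (simp add: cong_minus_minus_iff cong_scalar_left)

lemma unit_cond_yz_cong:
  assumes "[y = y'] (mod int p ^ n)" "[z = z'] (mod int p ^ n)" "unit_cond p n t w x y z s u"
  shows "unit_cond p n t w x y' z' s u"
proof -
  have "[u * y = u * y'] (mod int p ^ n)" using assms(1) by (rule cong_scalar_left)
  then show ?thesis
    using assms(2,3) unfolding unit_cond_def by (metis cong_sym cong_trans)
qed

lemma inf_cond_yz_cong:
  assumes "[y = y'] (mod int p ^ n)" "[z = z'] (mod int p ^ n)" "inf_cond p n t w x y z u"
  shows "inf_cond p n t w x y' z' u"
proof -
  have "[- (u * z) = - (u * z')] (mod int p ^ n)"
    using assms(2) by (rule cong_minus_scalar_left)
  then show ?thesis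
    using assms(1,3) unfolding inf_cond_def by (metis cong_sym cong_trans)
qed

lemma sol_count_yz_cong:
  assumes "[y = y'] (mod int p ^ n)" "[z = z'] (mod int p ^ n)"
  shows "sol_count p n t w x y z = sol_count p n t w x y' z'"
proof -
  have "branch_cond p n t w x y z s u \<longleftrightarrow> branch_cond p n t w x y' z' s u" for s u
    unfolding branch_cond_def
    using unit_cond_yz_cong inf_cond_yz_cong assms assms[THEN cong_sym] by meson
  then show ?thesis unfolding sol_count_def by simp
qed

lemma sol_count_swap:
  assumes "prime p" "1 \<le> n"
  shows "sol_count p n t w x y z = sol_count p n t w x (- z) (- y)"
  using assms(2)
proof (induction n arbitrary: w x y z rule: nat_induct_at_least)
  case base
  interpret prime_pair p 1 t using assms by unfold_locales auto
  show ?case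
  proof (cases "int p dvd w \<and> int p dvd x \<and> int p dvd y \<and> int p dvd z")
    case True
    \<comment> \<open>Both \<open>y\<close> and \<open>z\<close> are 0 modulo \<open>p\<close>, so
      the swap is invisible at this level.\<close>
    then have "[y = - z] (mod int p ^ 1)" "[z = - y] (mod int p ^ 1)" by (auto simp: cong_iff_dvd_diff)
    then show ?thesis by (rule sol_count_yz_cong)
  next
    case False
    then show ?thesis by (subst (1 2) sol_count_primitive) (auto simp: mult.commute)
  qed
next
  case (Suc n)
  interpret prime_pair p "Suc n" t using assms by unfold_locales auto
  show ?case
  proof (cases "int p dvd w \<and> int p dvd x \<and> int p dvd y \<and> int p dvd z")
    case True
    then obtain w' x' y' z' where "w = int p * w'" "x = int p * x'" "y = int p * y'" "z = int p * z'"
      by (meson dvdE)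
    then show ?thesis
      using Suc.IH[of w' x' y' z'] sol_count_mult_p[OF Suc.hyps, of w' x' y' z']
        sol_count_mult_p[OF Suc.hyps, of w' x' "- z'" "- y'"] by simp
  next
    case False
    then show ?thesis by (subst (1 2) sol_count_primitive) (auto simp: mult.commute)
  qed
qed

section \<open>Type membership as a branch condition\<close>

context prime_pair
begin

text \<open>For c = 1 the parameters are forced: j = x and k = -p^t z modulo p^(n+t). The congruence
  for \<open>w\<close> then shows that p^t divides \<open>w\<close>, and dividing by p^t leaves the
  modulus p^n.\<close>

lemma type_cond_inf: "type_cond p n t a 1 w x y z \<longleftrightarrow> inf_cond p n t w x y z a"
proof
  assume "type_cond p n t a 1 w x y z"
  then obtain j k where *: "[y = a * j] (mod int p ^ n)"
    "[x = j] (mod int p ^ (n + t))" "[w = a * k] (mod int p ^ (n + t))"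
     "[int p ^ t * z = - k] (mod int p ^ (n + t))" unfolding type_cond_def by auto
  have "[x = j] (mod int p ^ n)" using *(2) by (rule cong_dvd_modulus) (simp add: le_imp_power_dvd)
  then have 1: "[y = a * x] (mod int p ^ n)" using *(1) by (meson cong_scalar_left cong_sym cong_trans)
  have "[- (int p ^ t * z) = k] (mod int p ^ (n + t))" using *(4) by (metis cong_minus_minus_iff minus_minus)
  then have w: "[w = a * - (int p ^ t * z)] (mod int p ^ (n + t))"
    using *(3) by (meson cong_scalar_left cong_sym cong_trans)
  then have "int p ^ t dvd w \<longleftrightarrow> int p ^ t dvd a * - (int p ^ t * z)"
    by (rule cong_int_dvd_transfer) (simp add: le_imp_power_dvd)
  then have "int p ^ t dvd w" by (simp add: mult.left_commute)
  then obtain W where W: "w = int p ^ t * W" by (auto simp: dvd_def)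
  have "[int p ^ t * W = int p ^ t * (- (a * z))] (mod int p ^ (t + n))"
    using w W by (simp add: mult_ac add.commute)
  then have "[W = - (a * z)] (mod int p ^ n)" using cong_mult_cancel_pow p_nz by blast
  with 1 W show "inf_cond p n t w x y z a" unfolding inf_cond_def by blast
next
  assume "inf_cond p n t w x y z a"
  then obtain W where W: "w = int p ^ t * W"
    "[y = a * x] (mod int p ^ n)" "[W = - (a * z)] (mod int p ^ n)"
    unfolding inf_cond_def by blast
  have "[int p ^ t * W = int p ^ t * (- (a * z))] (mod int p ^ (t + n))"
    using W cong_mult_cancel_pow p_nz by blast
  then have "[w = a * - (int p ^ t * z)] (mod int p ^ (n + t))"
    using W by (simp add: mult_ac add.commute)
  with W show "type_cond p n t a 1 w x y z" unfolding type_cond_def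
    by (intro exI[of _ x] exI[of _ "- (int p ^ t * z)"]) simp
qed

text \<open>For a = 1 one has k = w, but \<open>y\<close> determines \<open>j\<close> only modulo
  p^n, whereas the congruence for \<open>x\<close> sees it modulo p^(n+t-s). For
  \<open>s < t\<close> the unit \<open>u\<close> closes this gap, and it also turns the divisibility
  of \<open>u * k\<close> by p^(t-s) into one of \<open>k\<close>.\<close>

lemma type_cond_unit:
  assumes "s \<le> t" "s = t \<or> \<not> int p dvd u"
  shows "type_cond p n t 1 (int p ^ s * u) w x y z \<longleftrightarrow> unit_cond p n t w x y z s u"
proof
  assume "type_cond p n t 1 (int p ^ s * u) w x y z"
  then obtain j k where *: "[y = j] (mod int p ^ n)"
    "[x = int p ^ s * u * j] (mod int p ^ (n + t))" "[w = k] (mod int p ^ (n + t))"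
     "[int p ^ t * z = - (int p ^ s * u * k)] (mod int p ^ (n + t))" unfolding type_cond_def by auto
  have e: "s + (n + (t - s)) = n + t" using assms by simp
  have pt: "int p ^ t = int p ^ s * int p ^ (t - s)" using assms by (simp flip: power_add)
  have "int p ^ s dvd x \<longleftrightarrow> int p ^ s dvd int p ^ s * u * j"
    using *(2) by (rule cong_int_dvd_transfer) (simp add: power_add pt)
  then obtain X where X: "x = int p ^ s * X" by (auto simp: dvd_def)
  have "[int p ^ s * X = int p ^ s * (u * j)] (mod int p ^ (s + (n + (t - s))))"
    using *(2) X e by (simp add: mult.assoc)
  then have "[X = u * j] (mod int p ^ (n + (t - s)))" using cong_mult_cancel_pow p_nz by blast
  then have "[X = u * j] (mod int p ^ n)" by (rule cong_dvd_modulus) (simp add: power_add)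
  then have 1: "[X = u * y] (mod int p ^ n)" using *(1) by (meson cong_scalar_left cong_sym cong_trans)
  have pz: "int p ^ s * (int p ^ (t - s) * z) = int p ^ t * z" by (simp only: pt mult.assoc)
  have "[int p ^ s * (int p ^ (t - s) * z) = int p ^ s * (- (u * k))] (mod int p ^ (s + (n + (t - s))))"
    unfolding pz e using *(4) by (simp add: mult.assoc)
  then have z: "[int p ^ (t - s) * z = - (u * k)] (mod int p ^ (n + (t - s)))"
    using cong_mult_cancel_pow p_nz by blast
  have "int p ^ (t - s) dvd int p ^ (t - s) * z \<longleftrightarrow> int p ^ (t - s) dvd - (u * k)"
    using z by (rule cong_int_dvd_transfer) (simp add: power_add)
  then have "int p ^ (t - s) dvd u * k" by simp
  moreover have "coprime u (int p ^ (t - s))" using assms coprime_pow_iff by auto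
  ultimately have "int p ^ (t - s) dvd k"
    by (metis coprime_commute coprime_dvd_mult_right_iff)
  then obtain K where K: "k = int p ^ (t - s) * K" by (auto simp: dvd_def)
  have w: "[w = k] (mod int p ^ (n + (t - s)))" using *(3)
    by (rule cong_dvd_modulus) (simp add: le_imp_power_dvd)
  then have "int p ^ (t - s) dvd w \<longleftrightarrow> int p ^ (t - s) dvd k"
    by (rule cong_int_dvd_transfer) (simp add: power_add)
  then obtain W where W: "w = int p ^ (t - s) * W" using K by (auto simp: dvd_def)
  have "[int p ^ (t - s) * z = - (u * w)] (mod int p ^ (n + (t - s)))"
    using z cong_minus_scalar_left[OF w] by (metis cong_sym cong_trans)
  then have "[int p ^ (t - s) * z = int p ^ (t - s) * (- (u * W))] (mod int p ^ ((t - s) + n))"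
    by (simp add: W mult_ac add.commute)
  then have "[z = - (u * W)] (mod int p ^ n)" using cong_mult_cancel_pow p_nz by blast
  with 1 X W show "unit_cond p n t w x y z s u" unfolding unit_cond_def by blast
next
  assume "unit_cond p n t w x y z s u"
  then obtain X W where *: "x = int p ^ s * X" "w = int p ^ (t - s) * W"
    "[X = u * y] (mod int p ^ n)" "[z = - (u * W)] (mod int p ^ n)"
    unfolding unit_cond_def by blast
  have e: "s + (n + (t - s)) = n + t" using assms by simp
  have pt: "int p ^ t = int p ^ s * int p ^ (t - s)" using assms by (simp flip: power_add)
  \<comment> \<open>Lifts \<open>y\<close> to the finer modulus: j = X/u works when \<open>u\<close>
    is a unit, and for \<open>s = t\<close> the moduli agree.\<close>
  have "\<exists>j. [y = j] (mod int p ^ n) \<and> [X = u * j] (mod int p ^ (n + (t - s)))"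
  proof (cases "s = t")
    case True
    then show ?thesis using * by (intro exI[of _ y]) simp
  next
    case False
    then obtain v where v: "[u * v = 1] (mod int p ^ (n + (t - s)))" "\<not> int p dvd v"
      using inverse_mod assms by blast
    have 1: "[X = u * (v * X)] (mod int p ^ (n + (t - s)))"
      using cong_scalar_right[OF v(1), of X] by (simp add: mult_ac cong_sym)
    then have "[X = u * (v * X)] (mod int p ^ n)" by (rule cong_dvd_modulus) (simp add: power_add)
    then have "[u * y = u * (v * X)] (mod int p ^ n)" using *(3) by (meson cong_sym cong_trans)
    moreover have "coprime u (int p ^ n)" using False assms coprime_pow_iff by auto
    ultimately have "[y = v * X] (mod int p ^ n)" by (simp add: cong_mult_lcancel)
    with 1 show ?thesis by blast
  qed
  then obtain j where j: "[y = j] (mod int p ^ n)" "[X = u * j] (mod int p ^ (n + (t - s)))" by blast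
  have "[x = int p ^ s * u * j] (mod int p ^ (n + t))"
    using j(2) cong_mult_cancel_pow[of "int p" s X "u * j" "n + (t - s)"] p_nz e *(1)
    by (simp add: mult.assoc)
  moreover have z: "[int p ^ t * z = int p ^ t * (- (u * W))] (mod int p ^ (t + n))"
    using *(4) cong_mult_cancel_pow p_nz by blast
  have "int p ^ t * (- (u * W)) = - (int p ^ s * u * w)"
    unfolding *(2) pt by simp
  with z have "[int p ^ t * z = - (int p ^ s * u * w)] (mod int p ^ (n + t))"
    by (simp only: add.commute)
  ultimately show "type_cond p n t 1 (int p ^ s * u) w x y z"
    unfolding type_cond_def using j(1)
    by (intro exI[of _ j] exI[of _ w]) simp
qed

end

section \<open>Representatives of the types\<close>

lemma card_filter_eq_sum: "finite S \<Longrightarrow> card {x \<in> S. Q x} = (\<Sum>x\<in>S. if Q x then 1 else 0)"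
  by (simp add: sum.If_cases Int_def)

context prime_pair
begin

lemma type_cond_cong:
  assumes "[a = a'] (mod int p ^ (n + t))" "[c = c'] (mod int p ^ (n + t))"
    and "type_cond p n t a c w x y z"
  shows "type_cond p n t a' c' w x y z"
proof -
  obtain j k where *: "[y = a * j] (mod int p ^ n)"
     "[x = c * j] (mod int p ^ (n + t))" "[w = a * k] (mod int p ^ (n + t))"
     "[int p ^ t * z = - (c * k)] (mod int p ^ (n + t))"
    using assms(3) unfolding type_cond_def by blast
  have "[a = a'] (mod int p ^ n)"
    using assms(1) by (rule cong_dvd_modulus) (simp add: le_imp_power_dvd)
  then have "[a * j = a' * j] (mod int p ^ n)" by (rule cong_scalar_right)
  moreover have "[c * j = c' * j] (mod int p ^ (n + t))" "[a * k = a' * k] (mod int p ^ (n + t))"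
    "[- (c * k) = - (c' * k)] (mod int p ^ (n + t))"
    using assms by (simp_all add: cong_scalar_right cong_minus_minus_iff)
  ultimately show ?thesis using * unfolding type_cond_def by (meson cong_trans)
qed

text \<open>The factor \<open>g\<close> is absorbed by \<open>j\<close> and \<open>k\<close>; the
  converse is the same step for an inverse of \<open>g\<close>. Together with
  \<open>type_cond_cong\<close> this shows that only the point (a : c) of the projective line modulo
  p^(n+t) matters.\<close>

lemma type_cond_scale:
  assumes "\<not> int p dvd g"
  shows "type_cond p n t (g * a) (g * c) w x y z \<longleftrightarrow> type_cond p n t a c w x y z"
proof -
  have imp: "type_cond p n t a c w x y z" if asm: "type_cond p n t (g * a) (g * c) w x y z" for g a c
  proof -
    obtain j k where "[y = g * a * j] (mod int p ^ n)"
     "[x = g * c * j] (mod int p ^ (n + t))" "[w = g * a * k] (mod int p ^ (n + t))"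
     "[int p ^ t * z = - (g * c * k)] (mod int p ^ (n + t))"
      using asm unfolding type_cond_def by blast
    then show ?thesis unfolding type_cond_def
      by (intro exI[of _ "g * j"] exI[of _ "g * k"]) (simp add: mult_ac)
  qed
  obtain v where v: "[g * v = 1] (mod int p ^ (n + t))" using inverse_mod assms by blast
  have "[b = v * (g * b)] (mod int p ^ (n + t))" for b
    using cong_scalar_right[OF v, of b] by (simp add: mult_ac cong_sym)
  then have "type_cond p n t (v * (g * a)) (v * (g * c)) w x y z" if "type_cond p n t a c w x y z"
    using type_cond_cong that by blast
  then show ?thesis using imp by blast
qed

lemma rep_systemD:
  assumes "rep_system p (n + t) n A C U"
  shows "bij_betw (\<lambda>a. a mod p ^ n) A {x. x < p ^ n \<and> p dvd x}"
    and "bij_betw (\<lambda>c. c mod p ^ (n + t)) C {x. x < p ^ (n + t) \<and> p ^ Suc t dvd x}"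
    and "s \<le> t \<Longrightarrow> bij_betw (\<lambda>u. u mod p ^ n) (U s) {x. x < p ^ n \<and> \<not> p dvd x}"
proof -
  have pos: "0 < p ^ k" for k using prime_p prime_gt_0_nat by simp
  have A: "multiple_reps p (p ^ n) A" and C: "multiple_reps (p ^ Suc t) (p ^ (n + t)) C"
    and U: "s \<le> t \<Longrightarrow> unit_reps (p ^ n) (U s)"
    using assms by (auto simp: rep_system_def)
  show "bij_betw (\<lambda>a. a mod p ^ n) A {x. x < p ^ n \<and> p dvd x}"
    using multiple_reps_mod_bij[OF A _ pos] n_ge by simp
  show "bij_betw (\<lambda>c. c mod p ^ (n + t)) C {x. x < p ^ (n + t) \<and> p ^ Suc t dvd x}"
    using multiple_reps_mod_bij[OF C _ pos] n_ge by (simp add: le_imp_power_dvd del: power_Suc)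
  have "coprime x (p ^ n) \<longleftrightarrow> \<not> p dvd x" for x
    using coprime_pow_iff[of "int x" n] n_ge by (simp flip: of_nat_power)
  then show "bij_betw (\<lambda>u. u mod p ^ n) (U s) {x. x < p ^ n \<and> \<not> p dvd x}" if "s \<le> t"
    using unit_reps_mod_bij[OF U[OF that] pos] by simp
qed

lemma rep_system_dvd:
  assumes "rep_system p (n + t) n A C U"
  shows "a \<in> A \<Longrightarrow> p dvd a" "c \<in> C \<Longrightarrow> p ^ Suc t dvd c"
    "s \<le> t \<Longrightarrow> u \<in> U s \<Longrightarrow> \<not> p dvd u"
  using assms coprime_pow_iff[of "int u" n] n_ge
  by (auto simp: rep_system_def multiple_reps_def unit_reps_def simp flip: of_nat_power)

lemma rep_system_finite:
  assumes "rep_system p (n + t) n A C U"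
  shows "finite A" "finite C" "s \<le> t \<Longrightarrow> finite (U s)"
  using bij_betw_finite[OF rep_systemD(1)[OF assms]] bij_betw_finite[OF rep_systemD(2)[OF assms]]
    bij_betw_finite[OF rep_systemD(3)[OF assms]] by simp_all

lemma finite_index_set:
  assumes "rep_system p (n + t) n A C U"
  shows "finite (index_set p t A C U)"
  using rep_system_finite[OF assms] unfolding index_set_def
  by (intro finite_UnI finite_imageI finite_UN_I) auto

lemma unit_power_eqD:
  fixes u v :: nat
  assumes "u * p ^ s = v * p ^ s'" "\<not> p dvd u" "\<not> p dvd v"
  shows "s = s' \<and> u = v"
proof -
  have p: "p > 0" using prime_p prime_gt_0_nat by simp
  have *: "s = s'" if asm: "u * p ^ s = v * p ^ s'" "\<not> p dvd u" "s \<le> s'" for u v s s'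
  proof (rule ccontr)
    assume "s \<noteq> s'"
    then have "s < s'" using asm(3) by simp
    then obtain d where "s' = s + Suc d" using less_iff_Suc_add by auto
    then have "u = p * (v * p ^ d)" using asm(1) p by (simp add: power_add)
    then show False using asm(2) by simp
  qed
  have "s = s'"
    using *[OF assms(1,2)] *[OF assms(1)[symmetric] assms(3)] nle_le by metis
  then show ?thesis using assms(1) p by simp
qed

text \<open>The pieces are disjoint by divisibility: a pair in the first two would give p | 1,
  second entries from \<open>C\<close> are multiples of p^(t+1), and those of the third sum have
  valuation exactly s <= t.\<close>

lemma cusp_sum_index_set:
  fixes F :: "nat \<Rightarrow> nat \<Rightarrow> 'b::comm_monoid_add"
  assumes "rep_system p (n + t) n A C U"
  shows "cusp_sum p (n + t) n A C U F = (\<Sum>(a, c)\<in>index_set p t A C U. F a c)"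
proof -
  note fin = rep_system_finite[OF assms] and dvd = rep_system_dvd[OF assms]
  have p: "\<not> p dvd 1" "p > 0" using prime_p prime_gt_0_nat by auto
  let ?f = "\<lambda>(a, c). F a c"
  have 1: "sum ?f ((\<lambda>a. (a, 1)) ` A) = (\<Sum>a\<in>A. F a 1)"
    by (subst sum.reindex) (auto simp: inj_on_def)
  have 2: "sum ?f ((\<lambda>c. (1, c)) ` C) = (\<Sum>c\<in>C. F 1 c)"
    by (subst sum.reindex) (auto simp: inj_on_def)
  have "sum ?f (\<Union>s\<in>{0..t}. (\<lambda>u. (1, u * p ^ s)) ` U s)
      = (\<Sum>s\<in>{0..t}. sum ?f ((\<lambda>u. (1, u * p ^ s)) ` U s))"
  proof (intro sum.UNION_disjoint ballI impI)
    fix s s' assume s: "s \<in> {0..t}" "s' \<in> {0..t}" "s \<noteq> s'"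
    show "(\<lambda>u. (1 :: nat, u * p ^ s)) ` U s \<inter> (\<lambda>u. (1, u * p ^ s')) ` U s' = {}"
    proof (intro equals0I)
      fix j :: "nat \<times> nat"
      assume "j \<in> (\<lambda>u. (1, u * p ^ s)) ` U s \<inter> (\<lambda>u. (1, u * p ^ s')) ` U s'"
      then obtain u v where uv: "u \<in> U s" "v \<in> U s'" "u * p ^ s = v * p ^ s'" by blast
      then have "\<not> p dvd u" "\<not> p dvd v" using dvd(3) s(1,2) by simp_all
      with uv(3) s(3) show False using unit_power_eqD by blast
    qed
  qed (use fin in auto)
  also have "\<dots> = (\<Sum>s\<in>{0..t}. \<Sum>u\<in>U s. F 1 (u * p ^ s))"
    using p by (intro sum.cong refl, subst sum.reindex) (auto simp: inj_on_def)
  finally have 3: "sum ?f (\<Union>s\<in>{0..t}. (\<lambda>u. (1, u * p ^ s)) ` U s)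
      = (\<Sum>s\<in>{0..t}. \<Sum>u\<in>U s. F 1 (u * p ^ s))" .
  have d1: "(\<lambda>a. (a, 1)) ` A \<inter> (\<lambda>c. (1, c)) ` C = {}"
  proof (rule equals0I)
    fix j :: "nat \<times> nat" assume "j \<in> (\<lambda>a. (a, 1)) ` A \<inter> (\<lambda>c. (1, c)) ` C"
    then have "1 \<in> A" by auto
    then show False using dvd(1) p(1) by blast
  qed
  have *: "c \<noteq> u * p ^ s" if "c \<in> C" "s \<le> t" "u \<in> U s" for c s u
  proof
    assume eq: "c = u * p ^ s"
    have "p ^ Suc s dvd p ^ Suc t" using that(2) by (intro le_imp_power_dvd) simp
    also have "\<dots> dvd u * p ^ s" using dvd(2) that(1) eq by blast
    finally have "p dvd u" using p by simp
    then show False using dvd(3) that by blast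
  qed
  have d2: "((\<lambda>a. (a, 1)) ` A \<union> (\<lambda>c. (1, c)) ` C) \<inter>
      (\<Union>s\<in>{0..t}. (\<lambda>u. (1, u * p ^ s)) ` U s) = {}"
  proof (rule equals0I)
    fix j assume j: "j \<in> ((\<lambda>a. (a, 1)) ` A \<union> (\<lambda>c. (1, c)) ` C) \<inter>
      (\<Union>s\<in>{0..t}. (\<lambda>u. (1, u * p ^ s)) ` U s)"
    then obtain s u where su: "s \<le> t" "u \<in> U s" "j = (1, u * p ^ s)" by auto
    from j consider a where "a \<in> A" "j = (a, 1)" | c where "c \<in> C" "j = (1, c)" by blast
    then show False
    proof cases
      case 1
      then show ?thesis using su(3) dvd(1) p(1) by auto
    next
      case 2
      then show ?thesis using su * by auto
    qed
  qed
  show ?thesis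
    unfolding cusp_sum_def index_set_def
    using fin d1 d2 by (subst sum.union_disjoint, simp, simp, simp)
      (subst sum.union_disjoint, simp, simp, simp, simp only: 1 2 3 add_diff_cancel_left')
qed

text \<open>The set \<open>A\<close> matches branch t + 1, \<open>C\<close> the multiples of p in
  branch t, and \<open>U s\<close> the units in branch s. All conditions are periodic, so the choice
  of representatives disappears from the count.\<close>

lemma card_index_set:
  assumes "rep_system p (n + t) n A C U"
  shows "card {j \<in> index_set p t A C U. type_cond p n t (int (fst j)) (int (snd j)) w x y z} =
    sol_count p n t w x y z"
proof -
  note bij = rep_systemD[OF assms] and fin = rep_system_finite[OF assms]
  let ?Q = "\<lambda>a c. type_cond p n t (int a) (int c) w x y z"
  let ?U = "\<lambda>s u. unit_cond p n t w x y z s (int u)"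
  let ?I = "\<lambda>u. inf_cond p n t w x y z (int u)"
  have cong_mod: "[int (u mod p ^ k) = int u] (mod int p ^ k)" for u k
    by (metis cong_int_iff cong_mod_left cong_refl of_nat_power)
  have U_mod: "?U s (u mod p ^ n) \<longleftrightarrow> ?U s u" for s u
    using unit_cond_cong cong_mod cong_sym by meson
  have I_mod: "?I (u mod p ^ n) \<longleftrightarrow> ?I u" for u
    using inf_cond_cong cong_mod cong_sym by meson
  have Q_mod: "?Q 1 (c mod p ^ (n + t)) \<longleftrightarrow> ?Q 1 c" for c
    using type_cond_cong cong_mod cong_sym cong_refl by meson
  have "card {j \<in> index_set p t A C U. ?Q (fst j) (snd j)} =
      (\<Sum>(a, c)\<in>index_set p t A C U. if ?Q a c then 1 else 0)"
    by (simp only: card_filter_eq_sum[OF finite_index_set[OF assms]] case_prod_unfold)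
  also have "\<dots> = cusp_sum p (n + t) n A C U (\<lambda>a c. if ?Q a c then 1 else 0)"
    by (rule cusp_sum_index_set[OF assms, symmetric])
  also have "\<dots> = card {a \<in> A. ?Q a 1} + card {c \<in> C. ?Q 1 c} +
      (\<Sum>s\<in>{0..t}. card {u \<in> U s. ?Q 1 (u * p ^ s)})"
  proof -
    have "(\<Sum>s\<in>{0..t}. \<Sum>u\<in>U s. if ?Q 1 (u * p ^ s) then 1 else 0) =
        (\<Sum>s\<in>{0..t}. card {u \<in> U s. ?Q 1 (u * p ^ s)})"
      using fin(3) by (intro sum.cong refl card_filter_eq_sum[symmetric]) simp
    then show ?thesis
      unfolding cusp_sum_def card_filter_eq_sum[OF fin(1)] card_filter_eq_sum[OF fin(2)] by simp
  qed
  also have "card {a \<in> A. ?Q a 1} = card {u. u < p ^ n \<and> p dvd u \<and> ?I u}"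
    using card_periodic_bij[OF bij(1), of ?I] I_mod by (simp add: type_cond_inf conj_assoc)
  also have "card {c \<in> C. ?Q 1 c} = card {u. u < p ^ n \<and> p dvd u \<and> ?U t u}"
  proof -
    have "card {c \<in> C. ?Q 1 c} = card {c. c < p ^ (n + t) \<and> p ^ Suc t dvd c \<and> ?Q 1 c}"
      using card_periodic_bij[OF bij(2), of "?Q 1"] Q_mod by (simp add: conj_assoc)
    \<comment> \<open>Substituting c = p^t u turns multiples of p^(t+1) modulo p^(n+t) into
      multiples of p modulo p^n.\<close>
    also have "{c. c < p ^ (n + t) \<and> p ^ Suc t dvd c \<and> ?Q 1 c} =
       (\<lambda>u. p ^ t * u) ` {u. u < p ^ n \<and> p dvd u \<and> ?U t u}"
    proof -
      have iff: "(p ^ t * u < p ^ (n + t) \<and> p ^ Suc t dvd p ^ t * u \<and> ?Q 1 (p ^ t * u)) \<longleftrightarrow>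
         u < p ^ n \<and> p dvd u \<and> ?U t u" for u
        using type_cond_unit[of t "int u"] p_nz by (simp add: power_add mult.commute[of _ "p ^ t"] mult.commute[of p])
      show ?thesis
      proof (intro equalityI subsetI)
        fix c assume c: "c \<in> {c. c < p ^ (n + t) \<and> p ^ Suc t dvd c \<and> ?Q 1 c}"
        then have "p ^ Suc t dvd c" by blast
        then have "p ^ t dvd c" by (rule power_le_dvd) simp
        then obtain u where "c = p ^ t * u" by (auto simp: dvd_def)
        with c iff show "c \<in> (\<lambda>u. p ^ t * u) ` {u. u < p ^ n \<and> p dvd u \<and> ?U t u}" by blast
      qed (use iff in blast)
    qed
    also have "card \<dots> = card {u. u < p ^ n \<and> p dvd u \<and> ?U t u}"
      using p_nz by (intro card_image) (simp add: inj_on_def)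
    finally show ?thesis .
  qed
  also have "(\<Sum>s\<in>{0..t}. card {u \<in> U s. ?Q 1 (u * p ^ s)}) =
      (\<Sum>s\<le>t. card {u. u < p ^ n \<and> \<not> p dvd u \<and> ?U s u})"
  proof (rule sum.cong)
    fix s assume "s \<in> {..t}"
    then have s: "s \<le> t" by simp
    have "{u \<in> U s. ?Q 1 (u * p ^ s)} = {u \<in> U s. ?U s u}"
      using type_cond_unit[OF s] rep_system_dvd(3)[OF assms s]
      by (auto simp: mult.commute)
    then show "card {u \<in> U s. ?Q 1 (u * p ^ s)} = card {u. u < p ^ n \<and> \<not> p dvd u \<and> ?U s u}"
      using card_periodic_bij[OF bij(3)[OF s], of "?U s"] U_mod by (simp add: conj_assoc)
  qed auto
  also have "card {u. u < p ^ n \<and> p dvd u \<and> ?I u} + card {u. u < p ^ n \<and> p dvd u \<and> ?U t u}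
      + (\<Sum>s\<le>t. card {u. u < p ^ n \<and> \<not> p dvd u \<and> ?U s u}) = sol_count p n t w x y z"
  proof -
    have "(\<Sum>s<t. card {u. u < p ^ n \<and> branch_cond p n t w x y z s u}) =
       (\<Sum>s<t. card {u. u < p ^ n \<and> \<not> p dvd u \<and> ?U s u})"
      by (intro sum.cong) (auto simp: branch_cond_def branch_ok_def)
    \<comment> \<open>Branch \<open>t\<close> is assembled from the second sum and the term s = t of
      the third.\<close>
    moreover have "{u. u < p ^ n \<and> branch_cond p n t w x y z t u} =
       {u. u < p ^ n \<and> p dvd u \<and> ?U t u} \<union> {u. u < p ^ n \<and> \<not> p dvd u \<and> ?U t u}"
      by (auto simp: branch_cond_def branch_ok_def)
    then have "card {u. u < p ^ n \<and> branch_cond p n t w x y z t u} =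
       card {u. u < p ^ n \<and> p dvd u \<and> ?U t u} + card {u. u < p ^ n \<and> \<not> p dvd u \<and> ?U t u}"
      by (simp, intro card_Un_disjoint) auto
    moreover have "{u. u < p ^ n \<and> branch_cond p n t w x y z (Suc t) u} =
       {u. u < p ^ n \<and> p dvd u \<and> ?I u}"
      by (auto simp: branch_cond_def branch_ok_def)
    ultimately show ?thesis unfolding sol_count_def
      by (simp flip: lessThan_Suc_atMost)
  qed
  finally show ?thesis .
qed

text \<open>One of \<open>a\<close>, \<open>c\<close> is a unit at \<open>p\<close>, so (a : c) can
  be scaled to (a/c : 1) with p | a, or to (1 : c/a). In the latter case the valuation of c/a,
  capped at \<open>t\<close>, selects \<open>C\<close> or some \<open>U s\<close>.\<close>

lemma index_set_exhaustive:
  assumes "rep_system p (n + t) n A C U" "coprime a c"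
  shows "\<exists>(a0, c0)\<in>index_set p t A C U. \<forall>w x y z.
     type_cond p n t (int a0) (int c0) w x y z \<longleftrightarrow> type_cond p n t a c w x y z"
proof -
  note bij = rep_systemD[OF assms(1)]
  have rep: "\<exists>a\<in>S. [int a = b] (mod int p ^ k)"
    if "bij_betw (\<lambda>a. a mod p ^ k) S {x. x < p ^ k \<and> P x}" "\<And>x. [int x = b] (mod int p ^ k) \<Longrightarrow> P x" for S k b P
  proof -
    define v where "v = nat (b mod int p ^ k)"
    have pos: "int p ^ k > 0" using prime_p prime_gt_0_nat by simp
    have v: "int v = b mod int p ^ k" using pos_mod_sign[OF pos, of b] by (simp add: v_def)
    have "v < p ^ k" using pos_mod_bound[OF pos, of b] v by (metis of_nat_less_iff of_nat_power)
    moreover have c: "[int v = b] (mod int p ^ k)" by (simp add: v)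
    ultimately have "v \<in> (\<lambda>a. a mod p ^ k) ` S" using that unfolding bij_betw_def by blast
    then obtain a where "a \<in> S" "v = a mod p ^ k" by blast
    moreover from this have "[int a = int v] (mod int p ^ k)"
      by (metis cong_int_iff cong_mod_right cong_refl of_nat_power)
    ultimately show ?thesis using c cong_trans by blast
  qed
  show ?thesis
  proof (cases "int p dvd a")
    case True
    then have "\<not> int p dvd c" using assms(2) prime_int
      by (meson coprime_common_divisor not_prime_unit)
    then obtain v where v: "[c * v = 1] (mod int p ^ (n + t))" "\<not> int p dvd v" using inverse_mod by blast
    have "p dvd x" if "[int x = v * a] (mod int p ^ n)" for x
      using cong_p_dvd[OF that] True by simp
    then obtain a0 where a0: "a0 \<in> A" "[int a0 = v * a] (mod int p ^ n)"
      using rep[OF bij(1)] by blast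
    have "type_cond p n t a c w x y z \<longleftrightarrow> type_cond p n t (int a0) (int 1) w x y z" for w x y z
    proof -
      have "type_cond p n t a c w x y z \<longleftrightarrow> type_cond p n t (v * a) (v * c) w x y z"
        using type_cond_scale[OF v(2)] by simp
      also have "\<dots> \<longleftrightarrow> type_cond p n t (v * a) 1 w x y z"
        using type_cond_cong[OF cong_refl] v(1) cong_sym by (metis mult.commute)
      \<comment> \<open>The representative agrees with v a only modulo p^n, too coarse for
        \<open>type_cond_cong\<close>; in the form \<open>inf_cond\<close> this modulus
        suffices.\<close>
      also have "\<dots> \<longleftrightarrow> type_cond p n t (int a0) 1 w x y z"
        unfolding type_cond_inf using inf_cond_cong a0(2) cong_sym by blast
      finally show ?thesis by simp
    qed
    moreover have "(a0, 1) \<in> index_set p t A C U" using a0 by (auto simp: index_set_def)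
    ultimately show ?thesis by blast
  next
    case False
    then obtain v where v: "[a * v = 1] (mod int p ^ (n + t))" "\<not> int p dvd v" using inverse_mod by blast
    have *: "type_cond p n t a c w x y z \<longleftrightarrow> type_cond p n t 1 (v * c) w x y z" for w x y z
    proof -
      have "type_cond p n t a c w x y z \<longleftrightarrow> type_cond p n t (v * a) (v * c) w x y z"
        using type_cond_scale[OF v(2)] by simp
      also have "\<dots> \<longleftrightarrow> type_cond p n t 1 (v * c) w x y z"
        using type_cond_cong[OF _ cong_refl] v(1) cong_sym by (metis mult.commute)
      finally show ?thesis .
    qed
    obtain s X where sX: "s \<le> t" "v * c = int p ^ s * X" "s = t \<or> \<not> int p dvd X"
      using extract_power by meson
    show ?thesis
    proof (cases "int p dvd X")
      case True
      then have [simp]: "s = t" using sX by simp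
      have "int p ^ Suc t dvd v * c" using True sX by simp
      then have "p ^ Suc t dvd x" if "[int x = v * c] (mod int p ^ (n + t))" for x
        using cong_int_dvd_transfer[OF that, of "int p ^ Suc t"] n_ge
        by (simp add: le_imp_power_dvd del: power_Suc flip: of_nat_power)
      then obtain c0 where c0: "c0 \<in> C" "[int c0 = v * c] (mod int p ^ (n + t))"
        using rep[OF bij(2)] by blast
      have "type_cond p n t (int 1) (int c0) w x y z \<longleftrightarrow> type_cond p n t a c w x y z" for w x y z
        unfolding * using type_cond_cong[OF cong_refl] c0(2) cong_sym by (metis of_nat_1)
      moreover have "(1, c0) \<in> index_set p t A C U" using c0 by (auto simp: index_set_def)
      ultimately show ?thesis by blast
    next
      case False
      then have "\<not> p dvd x" if "[int x = X] (mod int p ^ n)" for x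
        using cong_p_dvd[OF that] by simp
      then obtain u where u: "u \<in> U s" "[int u = X] (mod int p ^ n)"
        using rep[OF bij(3)[OF sX(1)]] by blast
      have pu: "\<not> int p dvd int u" using cong_p_dvd[OF u(2)] False by simp
      have "type_cond p n t (int 1) (int (u * p ^ s)) w x y z \<longleftrightarrow> type_cond p n t a c w x y z" for w x y z
      proof -
        have "type_cond p n t (int 1) (int (u * p ^ s)) w x y z \<longleftrightarrow> unit_cond p n t w x y z s (int u)"
          using type_cond_unit[OF sX(1), of "int u"] pu by (simp add: mult.commute)
        also have "\<dots> \<longleftrightarrow> unit_cond p n t w x y z s X"
          using unit_cond_cong u(2) cong_sym by blast
        also have "\<dots> \<longleftrightarrow> type_cond p n t a c w x y z"
          unfolding * sX(2) using type_cond_unit[OF sX(1)] sX(3) by simp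
        finally show ?thesis .
      qed
      moreover have "(1, u * p ^ s) \<in> index_set p t A C U" using u sX by (auto simp: index_set_def)
      ultimately show ?thesis by blast
    qed
  qed
qed

text \<open>The witness spans the line in which the two isotropic planes meet.\<close>

lemma common_primitive:
  assumes "coprime a c" "coprime a' (c' :: int)"
  obtains w x y z where "type_cond p n t a c w x y z" "type_cond p n t a' c' w x (- z) (- y)"
    "\<not> (int p dvd w \<and> int p dvd x \<and> int p dvd y \<and> int p dvd z)"
proof -
  \<comment> \<open>The common line is spanned by the matrix with rows (a c', a a') and (c c', c
    a'). Its coordinates divided by N' are p^t a a', c c', a c', -c a', and \<open>g\<close> removes
    the power of p they still share.\<close>
  define g where "g = gcd (gcd c c') (int p ^ t)"
  have g0: "g \<noteq> 0" using p_nz by (simp add: g_def)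
  obtain C where C: "c = g * C" unfolding g_def by (meson dvdE dvd_trans gcd_dvd1)
  obtain C' where C': "c' = g * C'" unfolding g_def by (meson dvdE dvd_trans gcd_dvd1 gcd_dvd2)
  obtain T where T: "int p ^ t = g * T" unfolding g_def by (meson dvdE gcd_dvd2)
  have "gcd (gcd c c') (int p ^ t) = g" by (simp add: g_def)
  then have "gcd (gcd (g * C) (g * C')) (g * T) = g" by (simp only: C C' T)
  moreover have pos: "g > 0" using g0 by (simp add: g_def)
  ultimately have "g * gcd (gcd C C') T = g"
    using gcd_mult_distrib_int[of g C C'] gcd_mult_distrib_int[of g "gcd C C'" T] by simp
  then have cop: "gcd (gcd C C') T = 1" using pos by simp
  show ?thesis
  proof
    show "type_cond p n t a c (T * a * a') (C * c') (a * C') (- (C * a'))"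
      unfolding type_cond_def
      by (intro exI[of _ C'] exI[of _ "T * a'"]) (simp add: C C' T mult_ac)
    show "type_cond p n t a' c' (T * a * a') (C * c') (- (- (C * a'))) (- (a * C'))"
      unfolding type_cond_def
      by (intro exI[of _ C] exI[of _ "T * a"]) (simp add: C C' T mult_ac)
    show "\<not> (int p dvd T * a * a' \<and> int p dvd C * c' \<and> int p dvd a * C' \<and> int p dvd - (C * a'))"
    proof
      assume *: "int p dvd T * a * a' \<and> int p dvd C * c' \<and> int p dvd a * C' \<and> int p dvd - (C * a')"
      have no: "\<not> (int p dvd i \<and> int p dvd j)" if "coprime i j" for i j
        using that prime_int by (meson coprime_common_divisor not_prime_unit)
      \<comment> \<open>Coprimality of a', c' gives p | C, so p | c and p does not divide a; hence p
        | C', so p does not divide a', and finally p | T, against \<open>cop\<close>.\<close>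
      have "int p dvd C * a'" using * by (simp only: dvd_minus_iff)
      with * have C_dvd: "int p dvd C" using no[OF assms(2)] p_dvd_mult by metis
      then have "\<not> int p dvd a" using no[OF assms(1)] C by simp
      with * have C'_dvd: "int p dvd C'" using p_dvd_mult by blast
      then have "\<not> int p dvd a'" using no[OF assms(2)] C' by simp
      with * \<open>\<not> int p dvd a\<close> have "int p dvd T" using p_dvd_mult by blast
      with C_dvd C'_dvd have "int p dvd gcd (gcd C C') T" by simp
      then show False using cop prime_int not_prime_unit by metis
    qed
  qed
qed

end

section \<open>The discriminant group in coordinates\<close>

lemma mat22_nth [simp]:
  "mat22 a b c d $ 1 $ 1 = a" "mat22 a b c d $ 1 $ 2 = b"
  "mat22 a b c d $ 2 $ 1 = c" "mat22 a b c d $ 2 $ 2 = d"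
  by (simp_all add: mat22_def)

lemma mat22_eq_iff: "X = Y \<longleftrightarrow> X$1$1 = Y$1$1 \<and> X$1$2 = Y$1$2 \<and> X$2$1 = Y$2$1 \<and> X$2$2 = (Y :: rat^2^2)$2$2"
  by (auto simp: vec_eq_iff forall_2)

lemma mscale_nth [simp]: "mscale t X $ i $ j = t * X $ i $ j"
  by (simp add: mscale_def)

lemma span_pair: "mat.span {X, Y} = {mscale s X + mscale t Y | s t. True}"
proof -
  have "Z \<in> mat.span {X, Y} \<longleftrightarrow> (\<exists>s t. Z - mscale s X = mscale t Y)" for Z
    by (simp add: mat.span_insert mat.span_empty image_iff Bex_def mat.span_singleton)
  moreover have "Z - mscale s X = mscale t Y \<longleftrightarrow> Z = mscale s X + mscale t Y" for s t Z
    by (metis add.commute diff_eq_eq)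
  ultimately show ?thesis by auto
qed

lemma plane1_iff:
  "X \<in> plane1 a c \<longleftrightarrow> (\<exists>s t. X = mat22 (of_int a * s) (of_int a * t) (of_int c * s) (of_int c * t))"
  unfolding plane1_def span_pair by (simp add: mat22_eq_iff mult.commute)

lemma plane2_iff:
  "X \<in> plane2 a c \<longleftrightarrow> (\<exists>s t. X = mat22 (of_int c * t) (of_int a * t) (of_int c * s) (of_int a * s))"
  unfolding plane2_def span_pair by (simp add: mat22_eq_iff mult.commute)

text \<open>The inverse of the map sending a matrix to $(w,x,y,z) = (Nb', N'c', N'a', -N'd')$.\<close>

definition dual_vec :: "nat \<Rightarrow> nat \<Rightarrow> int \<Rightarrow> int \<Rightarrow> int \<Rightarrow> int \<Rightarrow> rat^2^2" where
  "dual_vec N N' w x y z = mat22 (of_int y / of_nat N') (of_int w / of_nat N)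
     (of_int x / of_nat N') (- of_int z / of_nat N')"

definition dual_coset :: "nat \<Rightarrow> nat \<Rightarrow> int \<Rightarrow> int \<Rightarrow> int \<Rightarrow> int \<Rightarrow> (rat^2^2) set" where
  "dual_coset N N' w x y z = latt N N' #>\<^bsub>dual_group N N'\<^esub> dual_vec N N' w x y z"

section \<open>The dual lattice and its cosets\<close>

lemma dual_lattice_iff:
  assumes "N = N' * m" "0 < N"
  shows "X \<in> dual_lattice N N' \<longleftrightarrow> (\<exists>w x y z. X = dual_vec N N' w x y z)"
proof
  have nz: "of_nat N' \<noteq> (0 :: rat)" "of_nat m \<noteq> (0 :: rat)" and m: "N div N' = m" using assms by auto
  assume X: "X \<in> dual_lattice N N'"
  have "bform N' (mat22 (of_int a) (of_int b) (of_int (int m * c)) (of_int d)) X \<in> \<int>" for a b c d :: int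
  proof -
    have "mat22 (of_int a) (of_int b) (of_int (int m * c)) (of_int d) \<in> latt N N'"
      unfolding latt_iff m
      by (intro exI[of _ a] exI[of _ b] exI[of _ "int m * c"] exI[of _ d]) simp
    then show ?thesis using X unfolding dual_lattice_def by blast
  qed
  \<comment> \<open>Pairing with each of the four generators of the lattice isolates one entry of
    \<open>X\<close>.\<close>
  from this[of 1 0 0 0] this[of 0 1 0 0] this[of 0 0 1 0] this[of 0 0 0 1]
  have "of_nat N' * X$2$2 \<in> \<int>" "of_nat N' * X$2$1 \<in> \<int>" "of_nat N * X$1$2 \<in> \<int>" "of_nat N' * X$1$1 \<in> \<int>"
    by (simp_all add: bform_eq assms mult_ac)
  then obtain w x y z where "of_nat N' * X$2$2 = of_int z" "of_nat N' * X$2$1 = of_int x"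
    "of_nat N * X$1$2 = of_int w" "of_nat N' * X$1$1 = of_int y"
    unfolding Ints_def by auto
  then have "X = dual_vec N N' w x y (- z)"
    using nz assms by (simp add: mat22_eq_iff dual_vec_def field_simps)
  then show "\<exists>w x y z. X = dual_vec N N' w x y z" by blast
next
  have nz: "of_nat N' \<noteq> (0 :: rat)" "of_nat m \<noteq> (0 :: rat)" and m: "N div N' = m" using assms by auto
  assume "\<exists>w x y z. X = dual_vec N N' w x y z"
  then obtain w x y z where X: "X = dual_vec N N' w x y z" by blast
  have "bform N' Y X \<in> \<int>" if Y_mem: "Y \<in> latt N N'" for Y
  proof -
    obtain a b c d :: int where Y: "Y$1$1 = of_int a" "Y$1$2 = of_int b" "Y$2$1 = of_int (int m * c)"
      "Y$2$2 = of_int d" using Y_mem unfolding latt_iff m dvd_def by blast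
    have "bform N' Y X = of_int (a * z - d * y + b * x + c * w)"
      using nz by (simp add: bform_eq X Y dual_vec_def assms field_simps)
    then show ?thesis by (metis Ints_of_int)
  qed
  then show "X \<in> dual_lattice N N'" unfolding dual_lattice_def by blast
qed

text \<open>The coordinates \<open>w\<close> and \<open>x\<close> share the modulus N for different
  reasons: w/N has to be an integer, while x/N', the lower left entry, has to be a multiple of m =
  N/N'.\<close>

lemma latt_dual_vec_diff:
  assumes "N = N' * m" "0 < N"
  shows "dual_vec N N' w x y z - dual_vec N N' w' x' y' z' \<in> latt N N' \<longleftrightarrow>
    [w = w'] (mod int N) \<and> [x = x'] (mod int N) \<and> [y = y'] (mod int N') \<and> [z = z'] (mod int N')"
proof -
  have nz: "of_nat N' \<noteq> (0 :: rat)" "of_nat N \<noteq> (0 :: rat)" and m: "N div N' = m" using assms by auto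
  have int: "(\<exists>e::int. (of_int k :: rat) / of_nat M = of_int e) \<longleftrightarrow> int M dvd k" if "of_nat M \<noteq> (0 :: rat)" for k M
  proof -
    have "(of_int k :: rat) / of_nat M = of_int e \<longleftrightarrow> k = int M * e" for e
    proof -
      have "(of_int k :: rat) / of_nat M = of_int e \<longleftrightarrow> of_int k = (of_int (int M * e) :: rat)"
        using that by (simp add: field_simps)
      then show ?thesis unfolding of_int_eq_iff .
    qed
    then show ?thesis by (simp add: dvd_def)
  qed
  have int_m: "(\<exists>e::int. int m dvd e \<and> (of_int k :: rat) / of_nat N' = of_int e) \<longleftrightarrow> int N dvd k" for k
  proof -
    have "(of_int k :: rat) / of_nat N' = of_int e \<longleftrightarrow> k = int N' * e" for e
    proof -
      have "(of_int k :: rat) / of_nat N' = of_int e \<longleftrightarrow> of_int k = (of_int (int N' * e) :: rat)"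
        using nz by (simp add: field_simps)
      then show ?thesis unfolding of_int_eq_iff .
    qed
    then show ?thesis using assms by (auto simp: dvd_def mult.assoc)
  qed
  have "dual_vec N N' w x y z - dual_vec N N' w' x' y' z' \<in> latt N N' \<longleftrightarrow>
    (\<exists>e::int. (of_int (y - y') :: rat) / of_nat N' = of_int e) \<and>
    (\<exists>e::int. (of_int (w - w') :: rat) / of_nat N = of_int e) \<and>
    (\<exists>e::int. int m dvd e \<and> (of_int (x - x') :: rat) / of_nat N' = of_int e) \<and>
    (\<exists>e::int. (of_int (z' - z) :: rat) / of_nat N' = of_int e)"
    unfolding latt_iff m dual_vec_def by (simp add: diff_divide_distrib) blast
  also have "\<dots> \<longleftrightarrow> int N' dvd y - y' \<and> int N dvd w - w' \<and> int N dvd x - x' \<and> int N' dvd z' - z"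
    unfolding int[OF nz(1)] int[OF nz(2)] int_m ..
  finally show ?thesis by (auto simp: cong_iff_dvd_diff dvd_diff_commute)
qed

lemma rcos_latt: "latt N N' #>\<^bsub>dual_group N N'\<^esub> X = (\<lambda>l. l + X) ` latt N N'"
  by (auto simp: r_coset_def dual_group_def)

lemma rcos_latt_eq_iff:
  "latt N N' #>\<^bsub>dual_group N N'\<^esub> X = latt N N' #>\<^bsub>dual_group N N'\<^esub> Y \<longleftrightarrow> X - Y \<in> latt N N'"
proof -
  have z: "0 \<in> latt N N'" by (simp add: latt_iff)
  have add: "X + Y \<in> latt N N'" if "X \<in> latt N N'" "Y \<in> latt N N'" for X Y
    using that by (simp add: latt_iff) (metis dvd_add of_int_add)
  have minus: "- X \<in> latt N N'" if "X \<in> latt N N'" for X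
    using that by (simp add: latt_iff) (metis dvd_minus_iff of_int_minus)
  show ?thesis
  proof
    assume "latt N N' #>\<^bsub>dual_group N N'\<^esub> X = latt N N' #>\<^bsub>dual_group N N'\<^esub> Y"
    then have "X \<in> (\<lambda>l. l + Y) ` latt N N'" using z unfolding rcos_latt by (metis add_0 imageI)
    then show "X - Y \<in> latt N N'" by auto
  next
    assume *: "X - Y \<in> latt N N'"
    show "latt N N' #>\<^bsub>dual_group N N'\<^esub> X = latt N N' #>\<^bsub>dual_group N N'\<^esub> Y"
      unfolding rcos_latt
    proof (intro equalityI image_subsetI)
      fix l assume l: "l \<in> latt N N'"
      show "l + X \<in> (\<lambda>l. l + Y) ` latt N N'"
        using add[OF l *] by (intro image_eqI[of _ _ "l + (X - Y)"]) auto
      show "l + Y \<in> (\<lambda>l. l + X) ` latt N N'"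
        using add[OF l minus[OF *]] by (intro image_eqI[of _ _ "l + - (X - Y)"]) auto
    qed
  qed
qed

lemma dual_coset_eq_iff:
  assumes "N = N' * m" "0 < N"
  shows "dual_coset N N' w x y z = dual_coset N N' w' x' y' z' \<longleftrightarrow>
    [w = w'] (mod int N) \<and> [x = x'] (mod int N) \<and> [y = y'] (mod int N') \<and> [z = z'] (mod int N')"
  unfolding dual_coset_def rcos_latt_eq_iff latt_dual_vec_diff[OF assms] ..

lemma type_of_subset_cosets:
  assumes "N = N' * m" "0 < N"
  shows "type_of N N' I \<subseteq> {dual_coset N N' w x y z | w x y z. True}"
  unfolding type_of_def dual_coset_def using dual_lattice_iff[OF assms] by fastforce

lemma finite_dual_cosets:
  assumes "N = N' * m" "0 < N"
  shows "finite {dual_coset N N' w x y z | w x y z. True}"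
proof -
  let ?R = "{0..<int N}" and ?R' = "{0..<int N'}"
  have pos: "0 < int N" "0 < int N'" using assms by auto
  have "{dual_coset N N' w x y z | w x y z. True} \<subseteq>
    (\<lambda>(w, x, y, z). dual_coset N N' w x y z) ` (?R \<times> ?R \<times> ?R' \<times> ?R')"
  proof clarify
    fix w x y z
    have eq: "dual_coset N N' w x y z = dual_coset N N' (w mod int N) (x mod int N) (y mod int N') (z mod int N')"
      unfolding dual_coset_eq_iff[OF assms] by simp
    have mem: "(w mod int N, x mod int N, y mod int N', z mod int N') \<in> ?R \<times> ?R \<times> ?R' \<times> ?R'"
      using pos by simp
    show "dual_coset N N' w x y z \<in> (\<lambda>(w, x, y, z). dual_coset N N' w x y z) ` (?R \<times> ?R \<times> ?R' \<times> ?R')"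
      by (rule rev_image_eqI[OF mem]) (simp only: eq prod.case)
  qed
  then show ?thesis by (rule finite_subset) auto
qed

lemma finite_type_of:
  assumes "N = N' * m" "0 < N"
  shows "finite (type_of N N' I)"
  using finite_subset[OF type_of_subset_cosets finite_dual_cosets] assms by blast

lemma dual_coset_mem_type_of:
  assumes "N = N' * m" "0 < N"
  shows "dual_coset N N' w x y z \<in> type_of N N' I \<longleftrightarrow>
    (\<exists>w' x' y' z'. dual_vec N N' w' x' y' z' \<in> I \<and>
      [w = w'] (mod int N) \<and> [x = x'] (mod int N) \<and> [y = y'] (mod int N') \<and> [z = z'] (mod int N'))"
proof -
  have "dual_coset N N' w x y z \<in> type_of N N' I \<longleftrightarrow>
     (\<exists>X\<in>I \<inter> dual_lattice N N'. dual_coset N N' w x y z = latt N N' #>\<^bsub>dual_group N N'\<^esub> X)"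
    unfolding type_of_def by blast
  also have "\<dots> \<longleftrightarrow> (\<exists>w' x' y' z'. dual_vec N N' w' x' y' z' \<in> I \<and>
      dual_coset N N' w x y z = dual_coset N N' w' x' y' z')"
    unfolding dual_coset_def Bex_def Int_iff dual_lattice_iff[OF assms] by blast
  finally show ?thesis unfolding dual_coset_eq_iff[OF assms] .
qed

section \<open>Rational planes in coordinates\<close>

lemma of_int_int_combination:
  fixes s :: rat
  assumes "coprime a c" "of_int a * s \<in> \<int>" "of_int c * s \<in> \<int>"
  obtains j :: int where "s = of_int j"
proof -
  obtain i k where "i * a + k * c = 1" using assms(1) coprime_iff_gcd_eq_1 bezout_int by metis
  then have "(of_int i * of_int a + of_int k * of_int c :: rat) = 1"
    by (metis of_int_1 of_int_add of_int_mult)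
  then have "s = of_int i * (of_int a * s) + of_int k * (of_int c * s)"
    by (metis mult.assoc distrib_right mult_1)
  also have "\<dots> \<in> \<int>" by (intro Ints_add Ints_mult[OF Ints_of_int] assms(2,3))
  finally have "s \<in> \<int>" .
  then obtain j :: int where "s = of_int j" by (rule Ints_cases)
  then show ?thesis by (rule that)
qed

text \<open>Scaling the two rational plane parameters by N' and N clears the denominators, and
  coprimality of \<open>a\<close> and \<open>c\<close> makes them integers. The factor
  \<open>m\<close> in the last equation remains because d' = -z/N' involves the parameter scaled by
  N.\<close>

lemma dual_vec_plane1:
  assumes "N = N' * m" "0 < N" "coprime a c"
  shows "dual_vec N N' w x y z \<in> plane1 a c \<longleftrightarrow>
    (\<exists>j k. y = a * j \<and> x = c * j \<and> w = a * k \<and> int m * z = - (c * k))"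
proof -
  have nz: "of_nat N' \<noteq> (0 :: rat)" "of_nat m \<noteq> (0 :: rat)" using assms by auto
  have N: "of_nat N = (of_nat N' * of_nat m :: rat)" using assms by simp
  have entry: "of_int i / of_nat N' = s \<longleftrightarrow> of_int i = of_nat N' * s"
    "of_int i / of_nat N = s \<longleftrightarrow> of_int i = of_nat N * s" for s :: rat and i
    using nz assms(1) by (auto simp: field_simps)
  have last: "- of_int z / of_nat N' = of_int c * t \<longleftrightarrow> of_nat m * of_int z = - (of_int c * (of_nat N * t))" for t :: rat
  proof -
    have "- of_int z / of_nat N' = of_int c * t \<longleftrightarrow> - of_int z = of_nat N' * (of_int c * t)"
      using nz by (simp add: field_simps)
    also have "\<dots> \<longleftrightarrow> of_nat m * - of_int z = of_nat m * (of_nat N' * (of_int c * t))"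
      using nz by (simp only: mult_cancel_left) blast
    also have "\<dots> \<longleftrightarrow> of_nat m * of_int z = - (of_nat m * (of_nat N' * (of_int c * t)))"
      by (metis minus_minus mult_minus_right)
    finally show ?thesis by (simp add: N mult_ac)
  qed
  have "dual_vec N N' w x y z \<in> plane1 a c \<longleftrightarrow> (\<exists>s t. of_int y = of_int a * (of_nat N' * s :: rat) \<and>
     of_int w = of_int a * (of_nat N * t) \<and> of_int x = of_int c * (of_nat N' * s :: rat) \<and>
     of_nat m * of_int z = - (of_int c * (of_nat N * t) :: rat))"
    unfolding plane1_iff mat22_eq_iff dual_vec_def mat22_nth entry last by (simp add: mult.left_commute)
  also have "\<dots> \<longleftrightarrow> (\<exists>s t. of_int y = (of_int a * s :: rat) \<and> of_int w = of_int a * t \<and>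
     of_int x = (of_int c * s :: rat) \<and> of_nat m * of_int z = - (of_int c * t :: rat))" (is "?L \<longleftrightarrow> ?R")
  proof
    assume ?R
    then obtain s t where "of_int y = (of_int a * s :: rat) \<and> of_int w = of_int a * t \<and>
     of_int x = (of_int c * s :: rat) \<and> of_nat m * of_int z = - (of_int c * t :: rat)" by blast
    then show ?L using nz N by (intro exI[of _ "s / of_nat N'"] exI[of _ "t / of_nat N"]) simp
  qed blast
  also have "\<dots> \<longleftrightarrow> (\<exists>j k. y = a * j \<and> x = c * j \<and> w = a * k \<and> int m * z = - (c * k))" (is "?L \<longleftrightarrow> ?R")
  proof
    assume ?L
    then obtain s t :: rat where st: "of_int y = of_int a * s" "of_int w = of_int a * t"
     "of_int x = of_int c * s" "of_nat m * of_int z = - (of_int c * t)" by blast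
    have "of_int a * s \<in> \<int>" "of_int c * s \<in> \<int>" "of_int a * t \<in> \<int>"
      using st by (metis Ints_of_int)+
    moreover have "of_int c * t = of_int (- (int m * z))" using st(4) by simp
    then have "of_int c * t \<in> \<int>" by (metis Ints_of_int)
    ultimately obtain j k where [simp]: "s = of_int j" "t = of_int k"
      using of_int_int_combination[OF assms(3)] by metis
    have "of_int y = (of_int (a * j) :: rat)" "of_int w = (of_int (a * k) :: rat)"
      "of_int x = (of_int (c * j) :: rat)" "of_int (int m * z) = (of_int (- (c * k)) :: rat)"
      using st by simp_all
    then show ?R unfolding of_int_eq_iff by blast
  next
    assume ?R
    then obtain j k where jk: "y = a * j" "x = c * j" "w = a * k" "int m * z = - (c * k)" by blast
    have "of_nat m * of_int z = (of_int (int m * z) :: rat)" by simp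
    then have "of_nat m * of_int z = - (of_int c * of_int k :: rat)" unfolding jk(4) by simp
    then show ?L using jk by (intro exI[of _ "of_int j"] exI[of _ "of_int k"]) simp
  qed
  finally show ?thesis .
qed

text \<open>Exchanging the diagonal entries of a matrix interchanges the two families of planes;
  since y = N'a' and z = -N'd', this is the swap (y,z) -> (-z,-y).\<close>

lemma dual_vec_plane2:
  "dual_vec N N' w x y z \<in> plane2 a c \<longleftrightarrow> dual_vec N N' w x (- z) (- y) \<in> plane1 a c"
  unfolding plane1_iff plane2_iff mat22_eq_iff dual_vec_def by (auto simp: conj_ac)

context prime_pair
begin

lemma dual_coset_mem_plane1:
  assumes "coprime a c"
  shows "dual_coset (p ^ (n + t)) (p ^ n) w x y z \<in> type_of (p ^ (n + t)) (p ^ n) (plane1 a c) \<longleftrightarrow>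
    type_cond p n t a c w x y z"
proof -
  have N: "p ^ (n + t) = p ^ n * p ^ t" "0 < p ^ (n + t)"
    using prime_p prime_gt_0_nat by (auto simp: power_add)
  have pz: "int p ^ (n + t) = int p ^ t * int p ^ n" by (simp add: power_add)
  show ?thesis
    unfolding dual_coset_mem_type_of[OF N] dual_vec_plane1[OF N assms] of_nat_power
  proof
    assume "\<exists>w' x' y' z'. (\<exists>j k. y' = a * j \<and> x' = c * j \<and> w' = a * k \<and> int p ^ t * z' = - (c * k)) \<and>
       [w = w'] (mod int p ^ (n + t)) \<and> [x = x'] (mod int p ^ (n + t)) \<and> [y = y'] (mod int p ^ n) \<and>
       [z = z'] (mod int p ^ n)"
    then obtain z' j k where *: "int p ^ t * z' = - (c * k)" "[w = a * k] (mod int p ^ (n + t))"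
       "[x = c * j] (mod int p ^ (n + t))" "[y = a * j] (mod int p ^ n)" "[z = z'] (mod int p ^ n)" by blast
    have "[int p ^ t * z = int p ^ t * z'] (mod int p ^ (t + n))"
      using *(5) cong_mult_cancel_pow p_nz by blast
    then show "type_cond p n t a c w x y z" unfolding type_cond_def using * by (metis add.commute)
  next
    assume "type_cond p n t a c w x y z"
    then obtain j k where *: "[y = a * j] (mod int p ^ n)"
      "[x = c * j] (mod int p ^ (n + t))" "[w = a * k] (mod int p ^ (n + t))"
      "[int p ^ t * z = - (c * k)] (mod int p ^ (n + t))" unfolding type_cond_def by blast
    \<comment> \<open>A lattice vector on the plane needs an exact solution of p^t z' = -ck; the
      congruence shows that p^t divides ck.\<close>
    have "int p ^ t dvd int p ^ t * z \<longleftrightarrow> int p ^ t dvd - (c * k)"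
      using *(4) by (rule cong_int_dvd_transfer) (simp add: le_imp_power_dvd)
    then obtain z' where z': "- (c * k) = int p ^ t * z'" by (meson dvd_triv_left dvdE)
    then have "[int p ^ t * z = int p ^ t * z'] (mod int p ^ (t + n))" using *(4) by (simp add: add.commute)
    then have "[z = z'] (mod int p ^ n)" using cong_mult_cancel_pow p_nz by blast
    then show "\<exists>w' x' y' z'. (\<exists>j k. y' = a * j \<and> x' = c * j \<and> w' = a * k \<and> int p ^ t * z' = - (c * k)) \<and>
       [w = w'] (mod int p ^ (n + t)) \<and> [x = x'] (mod int p ^ (n + t)) \<and> [y = y'] (mod int p ^ n) \<and>
       [z = z'] (mod int p ^ n)" using * z' by metis
  qed
qed

lemma dual_coset_mem_plane2:
  assumes "coprime a c"
  shows "dual_coset (p ^ (n + t)) (p ^ n) w x y z \<in> type_of (p ^ (n + t)) (p ^ n) (plane2 a c) \<longleftrightarrow>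
    type_cond p n t a c w x (- z) (- y)"
proof -
  have N: "p ^ (n + t) = p ^ n * p ^ t" "0 < p ^ (n + t)"
    using prime_p prime_gt_0_nat by (auto simp: power_add)
  have neg: "[i = j] (mod m) \<longleftrightarrow> [- i = - j] (mod m)" for i j m :: int
    by (simp add: cong_minus_minus_iff)
  have "dual_coset (p ^ (n + t)) (p ^ n) w x y z \<in> type_of (p ^ (n + t)) (p ^ n) (plane2 a c) \<longleftrightarrow>
     dual_coset (p ^ (n + t)) (p ^ n) w x (- z) (- y) \<in> type_of (p ^ (n + t)) (p ^ n) (plane1 a c)"
    unfolding dual_coset_mem_type_of[OF N] dual_vec_plane2
    by (metis neg minus_minus)
  then show ?thesis using dual_coset_mem_plane1[OF assms] by simp
qed

end

section \<open>Uniqueness of the relation and isotropic planes\<close>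

lemma sum_fun_at: "(\<Sum>i\<in>S. f i) x = (\<Sum>i\<in>S. f i x)"
  by (induction S rule: infinite_finite_induct) (simp_all add: zero_fun_def)

lemma charfun_apply: "finite H \<Longrightarrow> charfun H x = (if x \<in> H then 1 else 0)"
  by (simp add: charfun_def basis_elt_def sum_fun_at)

text \<open>At an element lying in only one member \<open>H\<close> of \<open>S\<close> and one
  member \<open>K\<close> of \<open>T\<close>, a relation reads k H + k K = 0. The given relation
  and \<open>disj\<close> enter in the converse direction and in splitting the sum over the
  union.\<close>

lemma relation_unique:
  fixes S T :: "'a set set" and \<rho> k :: "'a set \<Rightarrow> complex"
  assumes fin: "finite S" "finite T" "\<And>H. H \<in> S \<union> T \<Longrightarrow> finite H"
    and disj: "S \<inter> T = {}" and ne: "S \<noteq> {}" "T \<noteq> {}"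
    and sep: "\<And>H K. H \<in> S \<Longrightarrow> K \<in> T \<Longrightarrow>
      \<exists>v\<in>H \<inter> K. (\<forall>H'\<in>S. v \<in> H' \<longrightarrow> H' = H) \<and> (\<forall>K'\<in>T. v \<in> K' \<longrightarrow> K' = K)"
    and rel: "(\<Sum>H\<in>S. charfun H) = (\<Sum>H\<in>T. charfun H)"
    and \<rho>: "\<And>H. H \<in> S \<Longrightarrow> \<rho> H = 1" "\<And>H. H \<in> T \<Longrightarrow> \<rho> H = - 1"
  shows "(\<Sum>H\<in>S \<union> T. smult (k H) (charfun H)) = 0 \<longleftrightarrow> (\<exists>t. \<forall>H\<in>S \<union> T. k H = t * \<rho> H)"
proof
  assume eq0: "(\<Sum>H\<in>S \<union> T. smult (k H) (charfun H)) = 0"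
  have opp: "k H = - k K" if HK: "H \<in> S" "K \<in> T" for H K
  proof -
    obtain v where v: "v \<in> H" "v \<in> K" "\<And>H'. H' \<in> S \<Longrightarrow> v \<in> H' \<longleftrightarrow> H' = H"
      "\<And>K'. K' \<in> T \<Longrightarrow> v \<in> K' \<longleftrightarrow> K' = K"
      using sep[OF HK] by blast
    have S: "(\<Sum>H\<in>S. k H * charfun H v) = (\<Sum>H'\<in>S. if H' = H then k H else 0)"
      using v fin(3) by (intro sum.cong) (auto simp: charfun_apply)
    have T: "(\<Sum>H\<in>T. k H * charfun H v) = (\<Sum>H'\<in>T. if H' = K then k K else 0)"
      using v fin(3) by (intro sum.cong) (auto simp: charfun_apply)
    have "0 = (\<Sum>H\<in>S \<union> T. smult (k H) (charfun H)) v" unfolding eq0 by simp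
    also have "\<dots> = (\<Sum>H\<in>S. k H * charfun H v) + (\<Sum>H\<in>T. k H * charfun H v)"
      unfolding sum_fun_at smult_def using fin disj by (simp add: sum.union_disjoint)
    also have "\<dots> = k H + k K" unfolding S T using fin HK by simp
    finally show ?thesis by (simp add: eq_neg_iff_add_eq_0)
  qed
  \<comment> \<open>A fixed pair links all coefficients: k H = -k K0 = k H0 on \<open>S\<close>, and
    k K = -k H0 on \<open>T\<close>.\<close>
  obtain H0 K0 where H0: "H0 \<in> S" "K0 \<in> T" using ne by blast
  have "k H = k H0 * \<rho> H" if "H \<in> S \<union> T" for H
  proof (cases "H \<in> S")
    case True
    then show ?thesis using opp[OF True H0(2)] opp[OF H0] \<rho>(1)[OF True] by simp
  next
    case False
    with that have "H \<in> T" by blast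
    then show ?thesis using opp[OF H0(1), of H] \<rho>(2) by simp
  qed
  then show "\<exists>t. \<forall>H\<in>S \<union> T. k H = t * \<rho> H" by blast
next
  assume "\<exists>t. \<forall>H\<in>S \<union> T. k H = t * \<rho> H"
  then obtain t where t: "\<And>H. H \<in> S \<union> T \<Longrightarrow> k H = t * \<rho> H" by blast
  have "(\<Sum>H\<in>S \<union> T. smult (k H) (charfun H)) v = 0" for v
  proof -
    have "(\<Sum>H\<in>S \<union> T. smult (k H) (charfun H)) v =
        (\<Sum>H\<in>S. k H * charfun H v) + (\<Sum>H\<in>T. k H * charfun H v)"
      unfolding sum_fun_at smult_def using fin disj by (simp add: sum.union_disjoint)
    also have "\<dots> = (\<Sum>H\<in>S. t * charfun H v) + (\<Sum>H\<in>T. - (t * charfun H v))"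
      using t \<rho> by (intro arg_cong2[of _ _ _ _ "(+)"] sum.cong) auto
    also have "\<dots> = t * ((\<Sum>H\<in>S. charfun H) v - (\<Sum>H\<in>T. charfun H) v)"
      unfolding sum_fun_at by (simp add: sum_distrib_left sum_negf right_diff_distrib)
    finally show ?thesis using rel by simp
  qed
  then show "(\<Sum>H\<in>S \<union> T. smult (k H) (charfun H)) = 0" by (auto simp: fun_eq_iff)
qed

section \<open>Classification of the isotropic planes\<close>

lemma proportional_coprime:
  fixes l m :: rat
  assumes "coprime a c" "of_int a * m = of_int c * l"
  obtains s where "l = of_int a * s" "m = of_int c * s"
proof -
  obtain i k where "i * a + k * c = 1" using assms(1) coprime_iff_gcd_eq_1 bezout_int by metis
  then have bez: "(of_int i * of_int a + of_int k * of_int c :: rat) = 1"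
    by (metis of_int_1 of_int_add of_int_mult)
  show ?thesis
  proof
    \<comment> \<open>The scalar is the Bezout combination i l + k m, which avoids dividing by
      \<open>a\<close> or \<open>c\<close>, either of which may be 0.\<close>
    have "of_int a * (of_int i * l + of_int k * m) = of_int i * of_int a * l + of_int k * (of_int a * m)"
      by (simp add: algebra_simps)
    also have "\<dots> = (of_int i * of_int a + of_int k * of_int c) * l"
      unfolding assms by (simp add: algebra_simps)
    finally show "l = of_int a * (of_int i * l + of_int k * m)" using bez by simp
    have "of_int c * (of_int i * l + of_int k * m) = of_int i * (of_int c * l) + of_int k * of_int c * m"
      by (simp add: algebra_simps)
    also have "\<dots> = (of_int i * of_int a + of_int k * of_int c) * m"
      unfolding assms(2)[symmetric] by (simp add: algebra_simps)
    finally show "m = of_int c * (of_int i * l + of_int k * m)" using bez by simp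
  qed
qed

lemma rat_pair_coprime:
  fixes l m :: rat
  obtains a c s where "coprime a c" "l = of_int a * s" "m = of_int c * s"
proof -
  obtain i k where l: "l = of_int i / of_int k" "k > 0" by (metis quotient_of_denom_pos quotient_of_div surj_pair)
  obtain j h where m: "m = of_int j / of_int h" "h > 0" by (metis quotient_of_denom_pos quotient_of_div surj_pair)
  show ?thesis
  proof (cases "i * h = 0 \<and> j * k = 0")
    case True
    then have "l = 0" "m = 0" using l m by auto
    then show ?thesis using that[of 1 0 0] by simp
  next
    case False
    then obtain a c where *: "i * h = a * gcd (i * h) (j * k)" "j * k = c * gcd (i * h) (j * k)" "coprime a c"
      using gcd_coprime_exists[of "i * h" "j * k"] by auto
    define g where "g = gcd (i * h) (j * k)"
    have g: "(of_int (i * h) :: rat) = of_int (a * g)" "(of_int (j * k) :: rat) = of_int (c * g)"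
      using * by (simp_all add: g_def)
    have lk: "l * of_int k = of_int i" "m * of_int h = of_int j"
      using l m by simp_all
    have "l * (of_int h * of_int k) = l * of_int k * of_int h" by (simp only: mult_ac)
    also have "\<dots> = of_int a * of_int g" unfolding lk using g(1) by simp
    finally have 1: "l * (of_int h * of_int k) = of_int a * of_int g" .
    have "m * (of_int h * of_int k) = m * of_int h * of_int k" by (simp only: mult_ac)
    also have "\<dots> = of_int c * of_int g" unfolding lk using g(2) by simp
    finally have "m * (of_int h * of_int k) = of_int c * of_int g" .
    moreover have "(of_int h :: rat) \<noteq> 0" "(of_int k :: rat) \<noteq> 0" using l m by simp_all
    ultimately have "l = of_int a * (of_int g / (of_int h * of_int k))" "m = of_int c * (of_int g / (of_int h * of_int k))"
      using 1 by (simp_all add: eq_divide_eq)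
    with *(3) that show ?thesis by blast
  qed
qed

text \<open>The columns of a singular matrix are proportional, and (a, c) is the primitive integral
  vector in their common direction, taken from the first column unless that is 0.\<close>

lemma singular_in_plane1:
  assumes "det (X :: rat^2^2) = 0"
  obtains a c where "coprime a c" "X \<in> plane1 a c"
proof -
  have det: "X$1$1 * X$2$2 = X$1$2 * X$2$1" using assms by (simp add: det_2)
  show ?thesis
  proof (cases "X$1$1 = 0 \<and> X$2$1 = 0")
    case True
    obtain a c s where "coprime a c" "X$1$2 = of_int a * s" "X$2$2 = of_int c * s"
      using rat_pair_coprime by blast
    with True have "X = mat22 (of_int a * 0) (of_int a * s) (of_int c * 0) (of_int c * s)" "coprime a c"
      by (auto simp: mat22_eq_iff)
    then show ?thesis using that unfolding plane1_iff by blast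
  next
    case False
    obtain a c s where ac: "coprime a c" "X$1$1 = of_int a * s" "X$2$1 = of_int c * s"
      using rat_pair_coprime by blast
    with False have "s \<noteq> 0" by auto
    moreover have "s * (of_int a * X$2$2) = s * (of_int c * X$1$2)"
      using det unfolding ac by (simp add: mult_ac)
    ultimately have "of_int a * X$2$2 = of_int c * X$1$2" by simp
    then obtain t where "X$1$2 = of_int a * t" "X$2$2 = of_int c * t"
      using proportional_coprime[OF ac(1)] by metis
    with ac have "X = mat22 (of_int a * s) (of_int a * t) (of_int c * s) (of_int c * t)"
      by (simp add: mat22_eq_iff)
    then show ?thesis using that ac(1) unfolding plane1_iff by blast
  qed
qed

text \<open>A vector of the span outside \<open>I\<close> would extend a basis of \<open>I\<close>
  to three independent vectors in the span of two.\<close>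

lemma subspace_eq_span_pair:
  assumes "mat.subspace I" "mat.dim I = 2" "I \<subseteq> mat.span {X, Y}"
  shows "I = mat.span {X, Y}"
proof -
  obtain B where B: "B \<subseteq> I" "mat.independent B" "I \<subseteq> mat.span B" "card B = 2"
    using mat.basis_exists[of I] assms(2) by metis
  then have finB: "finite B" by (metis card.infinite zero_neq_numeral)
  have span: "mat.span B = I" using B assms(1) by (simp add: mat.span_eq_iff mat.span_minimal subset_antisym)
  have "Z \<in> mat.span B" if Z: "Z \<in> mat.span {X, Y}" for Z
  proof (rule ccontr)
    assume notin: "Z \<notin> mat.span B"
    then have "mat.independent (insert Z B)" using B(2) by (simp add: mat.independent_insertI)
    moreover have "insert Z B \<subseteq> mat.span {X, Y}" using Z B assms by auto
    ultimately have "card (insert Z B) \<le> card {X, Y}"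
      using mat.independent_span_bound[of "{X, Y}" "insert Z B"] by simp
    moreover have "Z \<notin> B" using notin mat.span_base by blast
    moreover have "card {X, Y} \<le> 2" by (simp add: card_insert_if)
    ultimately show False using B(4) finB by simp
  qed
  then show ?thesis using span assms(3) by blast
qed

lemma dim_pair:
  assumes "X \<notin> mat.span {Y}" "Y \<noteq> 0"
  shows "mat.dim (mat.span {X, Y}) = 2"
proof -
  have "mat.independent {X, Y}" using assms by (simp add: mat.independent_insertI mat.dependent_single)
  moreover have "X \<noteq> Y" using assms(1) mat.span_base by blast
  ultimately show ?thesis by (simp add: mat.dim_eq_card_independent)
qed

text \<open>Two singular basis matrices are products of a column and a row, and det(X + Y) is then
  the determinant of the two columns times that of the two rows. One factor vanishes: a common
  column direction gives \<open>plane1\<close>, a common row direction gives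
  \<open>plane2\<close>.\<close>

lemma isotropic_plane_iff:
  assumes "0 < N'"
  shows "isotropic_plane N' I \<longleftrightarrow> (\<exists>a c. coprime a c \<and> (I = plane1 a c \<or> I = plane2 a c))"
proof
  assume I: "isotropic_plane N' I"
  then have sub: "mat.subspace I" and dim: "mat.dim I = 2" and iso: "\<And>X. X \<in> I \<Longrightarrow> det X = 0"
    using assms by (auto simp: isotropic_plane_def qform_def)
  obtain B where B: "B \<subseteq> I" "mat.independent B" "I \<subseteq> mat.span B" "card B = 2"
    using mat.basis_exists[of I] dim by metis
  then obtain X Y where XY: "B = {X, Y}" "X \<noteq> Y" by (auto simp: card_2_iff)
  have X0: "X \<noteq> 0" using B(2) XY mat.dependent_zero by blast
  have XI: "X \<in> I" "Y \<in> I" using B XY by auto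
  obtain a c where ac: "coprime a c" "X \<in> plane1 a c" using singular_in_plane1 iso XI by blast
  obtain a' c' where ac': "coprime a' c'" "Y \<in> plane1 a' c'" using singular_in_plane1 iso XI by blast
  obtain s t where X: "X = mat22 (of_int a * s) (of_int a * t) (of_int c * s) (of_int c * t)"
    using ac plane1_iff by auto
  obtain s' t' where Y: "Y = mat22 (of_int a' * s') (of_int a' * t') (of_int c' * s') (of_int c' * t')"
    using ac' plane1_iff by auto
  have "det (X + Y) = 0" using XI iso sub by (simp add: mat.subspace_add)
  then have "(of_int a * of_int c' - of_int a' * of_int c) * (s * t' - t * s') = 0"
    unfolding X Y by (simp add: det_2 algebra_simps)
  then consider "of_int a * of_int c' = (of_int c * of_int a' :: rat)" | "s * t' = t * s'" by auto
  then show "\<exists>a c. coprime a c \<and> (I = plane1 a c \<or> I = plane2 a c)"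
  proof cases
    case 1
    obtain u where u: "of_int a' = (of_int a * u :: rat)" "of_int c' = (of_int c * u :: rat)"
      using proportional_coprime[OF ac(1) 1] by metis
    have "Y \<in> plane1 a c" unfolding plane1_iff Y
      by (intro exI[of _ "u * s'"] exI[of _ "u * t'"]) (simp add: u mult_ac)
    with ac(2) have "mat.span B \<subseteq> plane1 a c"
      unfolding XY plane1_def by (intro mat.span_minimal) auto
    then have "I = plane1 a c" using B(3) subspace_eq_span_pair[OF sub dim] unfolding plane1_def by blast
    then show ?thesis using ac(1) by blast
  next
    case 2
    \<comment> \<open>The order c2, a2 is deliberate: the rows of matrices in
      \<open>plane2 a c\<close> are multiples of (c, a).\<close>
    obtain c2 a2 u where u: "coprime c2 a2" "s = of_int c2 * u" "t = of_int a2 * u"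
      using rat_pair_coprime by blast
    have "u \<noteq> 0" using X0 unfolding X u by (auto simp: mat22_eq_iff)
    moreover have "u * (of_int c2 * t') = u * (of_int a2 * s')" using 2 unfolding u by (simp add: mult_ac)
    ultimately have "of_int c2 * t' = of_int a2 * s'" by simp
    then obtain u' where u': "s' = of_int c2 * u'" "t' = of_int a2 * u'"
      using proportional_coprime[OF u(1)] by metis
    have "X \<in> plane2 a2 c2" unfolding plane2_iff X u
      by (intro exI[of _ "of_int c * u"] exI[of _ "of_int a * u"]) (simp add: mult_ac)
    moreover have "Y \<in> plane2 a2 c2" unfolding plane2_iff Y u'
      by (intro exI[of _ "of_int c' * u'"] exI[of _ "of_int a' * u'"]) (simp add: mult_ac)
    ultimately have "mat.span B \<subseteq> plane2 a2 c2"
      unfolding XY plane2_def by (intro mat.span_minimal) auto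
    then have "I = plane2 a2 c2" using B(3) subspace_eq_span_pair[OF sub dim] unfolding plane2_def by blast
    then show ?thesis using u(1) by (intro exI[of _ a2] exI[of _ c2]) (simp add: coprime_commute)
  qed
next
  assume "\<exists>a c. coprime a c \<and> (I = plane1 a c \<or> I = plane2 a c)"
  then obtain a c where ac: "coprime a c" "I = plane1 a c \<or> I = plane2 a c" by blast
  have nz: "a \<noteq> 0 \<or> c \<noteq> 0" using ac(1) by auto
  have sub: "mat.subspace I" using ac(2) by (auto simp: plane1_def plane2_def)
  moreover have "mat.dim (plane1 a c) = 2" unfolding plane1_def
    using nz by (intro dim_pair) (auto simp: mat.span_singleton mat22_eq_iff)
  moreover have "mat.dim (plane2 a c) = 2" unfolding plane2_def
    using nz by (intro dim_pair) (auto simp: mat.span_singleton mat22_eq_iff)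
  moreover have "qform N' X = 0" if "X \<in> I" for X
    using that ac(2) by (auto simp: plane1_iff plane2_iff qform_def det_2)
  ultimately show "isotropic_plane N' I" using ac(2) by (auto simp: isotropic_plane_def)
qed

section \<open>The relation between the types\<close>

lemma index_set_coprime: "(a, c) \<in> index_set p t A C U \<Longrightarrow> coprime (int a) (int c)"
  by (auto simp: index_set_def)

lemma type_of_eqI:
  assumes "N = N' * m" "0 < N"
    and "\<And>w x y z. dual_coset N N' w x y z \<in> type_of N N' I \<longleftrightarrow> dual_coset N N' w x y z \<in> type_of N N' J"
  shows "type_of N N' I = type_of N N' J"
proof (rule Set.set_eqI)
  fix v
  show "v \<in> type_of N N' I \<longleftrightarrow> v \<in> type_of N N' J"
  proof (cases "\<exists>w x y z. v = dual_coset N N' w x y z")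
    case True
    then show ?thesis using assms(3) by blast
  next
    case False
    then show ?thesis using type_of_subset_cosets[OF assms(1,2)] by blast
  qed
qed

locale cusp_types = prime_pair +
  fixes N N' :: nat
  assumes N_def: "N = p ^ (n + t)" and N'_def: "N' = p ^ n"
begin

lemma N_eq: "N = N' * p ^ t" and N_pos: "0 < N" and N'_pos: "0 < N'"
  using prime_p prime_gt_0_nat by (auto simp: N_def N'_def power_add)

lemma mem_plane1 [simp]:
  "coprime a c \<Longrightarrow> dual_coset N N' w x y z \<in> type_of N N' (plane1 a c) \<longleftrightarrow> type_cond p n t a c w x y z"
  unfolding N_def N'_def by (rule dual_coset_mem_plane1)

lemma mem_plane2 [simp]:
  "coprime a c \<Longrightarrow> dual_coset N N' w x y z \<in> type_of N N' (plane2 a c) \<longleftrightarrow>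
    type_cond p n t a c w x (- z) (- y)"
  unfolding N_def N'_def by (rule dual_coset_mem_plane2)

abbreviation "types1 J \<equiv> (\<lambda>j. H1 N N' (fst j) (snd j)) ` J"
abbreviation "types2 J \<equiv> (\<lambda>j. H2 N N' (fst j) (snd j)) ` J"

lemma finite_type: "finite (type_of N N' I)"
  using N_eq N_pos by (rule finite_type_of)

lemma finite_H: "finite (H1 N N' a c)" "finite (H2 N N' a c)"
  by (simp_all add: H1_def H2_def finite_type)

lemma type_plane1_in_types1:
  assumes "rep_system p (n + t) n A C U" "coprime a c"
  shows "type_of N N' (plane1 a c) \<in> types1 (index_set p t A C U)"
proof -
  obtain a0 c0 where *: "(a0, c0) \<in> index_set p t A C U"
    "\<And>w x y z. type_cond p n t (int a0) (int c0) w x y z \<longleftrightarrow> type_cond p n t a c w x y z"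
    using index_set_exhaustive[OF assms] by blast
  have "type_of N N' (plane1 a c) = H1 N N' a0 c0"
    unfolding H1_def using * index_set_coprime[OF *(1)] assms(2)
    by (intro type_of_eqI[OF N_eq N_pos]) simp
  then show ?thesis using *(1) by force
qed

lemma type_plane2_in_types2:
  assumes "rep_system p (n + t) n A C U" "coprime a c"
  shows "type_of N N' (plane2 a c) \<in> types2 (index_set p t A C U)"
proof -
  obtain a0 c0 where *: "(a0, c0) \<in> index_set p t A C U"
    "\<And>w x y z. type_cond p n t (int a0) (int c0) w x y z \<longleftrightarrow> type_cond p n t a c w x y z"
    using index_set_exhaustive[OF assms] by blast
  have "type_of N N' (plane2 a c) = H2 N N' a0 c0"
    unfolding H2_def using * index_set_coprime[OF *(1)] assms(2)
    by (intro type_of_eqI[OF N_eq N_pos]) simp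
  then show ?thesis using *(1) by force
qed

lemma Types_eq:
  assumes "rep_system p (n + t) n A C U" "rep_system p (n + t) n A' C' U'"
  shows "Types N N' = types1 (index_set p t A C U) \<union> types2 (index_set p t A' C' U')"
proof (intro equalityI subsetI)
  fix H assume "H \<in> Types N N'"
  then show "H \<in> types1 (index_set p t A C U) \<union> types2 (index_set p t A' C' U')"
    using type_plane1_in_types1[OF assms(1)] type_plane2_in_types2[OF assms(2)]
    unfolding Types_def isotropic_plane_iff[OF N'_pos] by blast
next
  fix H assume "H \<in> types1 (index_set p t A C U) \<union> types2 (index_set p t A' C' U')"
  then show "H \<in> Types N N'"
  proof
    assume "H \<in> types1 (index_set p t A C U)"
    then obtain a c where "coprime (int a) (int c)" "H = type_of N N' (plane1 (int a) (int c))"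
      using index_set_coprime unfolding H1_def by force
    then show ?thesis unfolding Types_def isotropic_plane_iff[OF N'_pos] by blast
  next
    assume "H \<in> types2 (index_set p t A' C' U')"
    then obtain a c where "coprime (int a) (int c)" "H = type_of N N' (plane2 (int a) (int c))"
      using index_set_coprime unfolding H2_def by force
    then show ?thesis unfolding Types_def isotropic_plane_iff[OF N'_pos] by blast
  qed
qed

section \<open>Separating the types\<close>

lemma primitive_index_unique:
  assumes "rep_system p (n + t) n A C U"
    and "\<not> (int p dvd w \<and> int p dvd x \<and> int p dvd y \<and> int p dvd z)"
    and "i \<in> index_set p t A C U" "type_cond p n t (int (fst i)) (int (snd i)) w x y z"
    and "j \<in> index_set p t A C U" "type_cond p n t (int (fst j)) (int (snd j)) w x y z"
  shows "i = j"
proof -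
  let ?S = "{j \<in> index_set p t A C U. type_cond p n t (int (fst j)) (int (snd j)) w x y z}"
  have "card ?S \<le> 1"
    unfolding card_index_set[OF assms(1)] sol_count_primitive[OF assms(2)] by simp
  moreover have "finite ?S" using finite_index_set[OF assms(1)] by simp
  ultimately have "\<forall>i\<in>?S. \<forall>j\<in>?S. i = j" using card_le_Suc0_iff_eq[of ?S] by simp
  then show ?thesis using assms(3-6) by blast
qed

text \<open>Stated for indices and not for types, so that it also yields the injectivity of
  \<open>H1\<close> and \<open>H2\<close> on the index sets and the disjointness of the two
  families.\<close>

lemma separating_coset:
  assumes "rep_system p (n + t) n A C U" "rep_system p (n + t) n A' C' U'"
    and "i \<in> index_set p t A C U" "j \<in> index_set p t A' C' U'"
  shows "\<exists>v \<in> H1 N N' (fst i) (snd i) \<inter> H2 N N' (fst j) (snd j).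
    (\<forall>i'\<in>index_set p t A C U. v \<in> H1 N N' (fst i') (snd i') \<longrightarrow> i' = i) \<and>
    (\<forall>j'\<in>index_set p t A' C' U'. v \<in> H2 N N' (fst j') (snd j') \<longrightarrow> j' = j)"
proof -
  have cop: "coprime (int (fst i')) (int (snd i'))" if "i' \<in> index_set p t A C U" for i' A C U
    using index_set_coprime that by (metis prod.collapse)
  obtain w x y z where *: "type_cond p n t (int (fst i)) (int (snd i)) w x y z"
    "type_cond p n t (int (fst j)) (int (snd j)) w x (- z) (- y)"
    "\<not> (int p dvd w \<and> int p dvd x \<and> int p dvd y \<and> int p dvd z)"
    using common_primitive[OF cop[OF assms(3)] cop[OF assms(4)]] by blast
  from *(3) have prim: "\<not> (int p dvd w \<and> int p dvd x \<and> int p dvd - z \<and> int p dvd - y)" by auto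
  show ?thesis
  proof (intro bexI[of _ "dual_coset N N' w x y z"] conjI ballI impI)
    fix i' assume "i' \<in> index_set p t A C U" "dual_coset N N' w x y z \<in> H1 N N' (fst i') (snd i')"
    then show "i' = i"
      using primitive_index_unique[OF assms(1) *(3)] assms(3) *(1) cop by (simp add: H1_def)
  next
    fix j' assume "j' \<in> index_set p t A' C' U'" "dual_coset N N' w x y z \<in> H2 N N' (fst j') (snd j')"
    then show "j' = j"
      using primitive_index_unique[OF assms(2) prim] assms(4) *(2) cop by (simp add: H2_def)
  qed (use * cop assms(3,4) in \<open>simp add: H1_def H2_def\<close>)
qed

lemma index_set_nonempty:
  assumes "rep_system p (n + t) n A C U"
  shows "index_set p t A C U \<noteq> {}"
  using index_set_exhaustive[OF assms, of 1 0] by auto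

text \<open>The coset separating \<open>i\<close> from the other indices, paired with any
  \<open>j\<close>, lies in \<open>H1\<close> of index \<open>i'\<close> too if the types
  agree.\<close>

lemma inj_on_H1:
  assumes "rep_system p (n + t) n A C U"
  shows "inj_on (\<lambda>j. H1 N N' (fst j) (snd j)) (index_set p t A C U)"
proof (rule inj_onI)
  fix i i' assume i: "i \<in> index_set p t A C U" "i' \<in> index_set p t A C U"
    "H1 N N' (fst i) (snd i) = H1 N N' (fst i') (snd i')"
  obtain j where "j \<in> index_set p t A C U" using index_set_nonempty[OF assms] by blast
  from separating_coset[OF assms assms i(1) this] show "i = i'" using i(2,3) by auto
qed

lemma inj_on_H2:
  assumes "rep_system p (n + t) n A C U"
  shows "inj_on (\<lambda>j. H2 N N' (fst j) (snd j)) (index_set p t A C U)"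
proof (rule inj_onI)
  fix j j' assume j: "j \<in> index_set p t A C U" "j' \<in> index_set p t A C U"
    "H2 N N' (fst j) (snd j) = H2 N N' (fst j') (snd j')"
  obtain i where "i \<in> index_set p t A C U" using index_set_nonempty[OF assms] by blast
  from separating_coset[OF assms assms this j(1)] show "j = j'" using j(2,3) by auto
qed

text \<open>If \<open>H\<close> belonged to both families, then for every \<open>j\<close> the coset
  separating (i, j) would lie in \<open>H\<close>, the type with index \<open>j0\<close>, forcing j
  = j0. The second family would have one member only, yet the planes for (1, 0) and (0, 1) have
  different types.\<close>

lemma types_disjoint:
  assumes "rep_system p (n + t) n A C U" "rep_system p (n + t) n A' C' U'"
  shows "types1 (index_set p t A C U) \<inter> types2 (index_set p t A' C' U') = {}"
proof (rule equals0I)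
  let ?J = "index_set p t A C U" and ?J' = "index_set p t A' C' U'"
  fix H assume "H \<in> types1 ?J \<inter> types2 ?J'"
  then obtain i j0 where i: "i \<in> ?J" "H = H1 N N' (fst i) (snd i)"
    and j0: "j0 \<in> ?J'" "H = H2 N N' (fst j0) (snd j0)" by auto
  have all: "K = H" if K: "K \<in> types2 ?J'" for K
  proof -
    obtain j where j: "j \<in> ?J'" "K = H2 N N' (fst j) (snd j)" using K by auto
    from separating_coset[OF assms i(1) j(1)] have "j0 = j" using j0 i(2) by auto
    then show ?thesis using j j0 by simp
  qed
  have "type_of N N' (plane2 1 0) = type_of N N' (plane2 0 1)"
    using all type_plane2_in_types2[OF assms(2)] by (metis coprime_1_left coprime_1_right)
  \<comment> \<open>The element (1,0,0,0) tells the two apart: w = ak allows w = 1 for a = 1, but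
    forces w = 0 modulo N for a = 0.\<close>
  moreover have "dual_coset N N' 1 0 0 0 \<in> type_of N N' (plane2 1 0)"
  proof -
    have "type_cond p n t 1 0 1 0 0 0"
      unfolding type_cond_def by (intro exI[of _ 0] exI[of _ 1]) simp
    then show ?thesis by simp
  qed
  moreover have "dual_coset N N' 1 0 0 0 \<notin> type_of N N' (plane2 0 1)"
  proof -
    have "\<not> [1 = 0] (mod int p ^ (n + t))"
    proof -
      have "\<not> int p dvd 1" using prime_int not_prime_unit by blast
      then show ?thesis using n_ge by (simp add: cong_0_iff is_unit_power_iff del: zdvd1_eq)
    qed
    then show ?thesis by (simp add: type_cond_def)
  qed
  ultimately show False by simp
qed

section \<open>The relation and its coefficient vector\<close>

lemma charfun_relation:
  assumes "rep_system p (n + t) n A C U" "rep_system p (n + t) n A' C' U'"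
  shows "cusp_sum p (n + t) n A C U (\<lambda>a c. charfun (H1 N N' a c)) =
    cusp_sum p (n + t) n A' C' U' (\<lambda>a c. charfun (H2 N N' a c))"
proof
  fix v
  let ?J = "index_set p t A C U" and ?J' = "index_set p t A' C' U'"
  have fin: "finite ?J" "finite ?J'" using finite_index_set assms by blast+
  have cop: "coprime (int (fst i')) (int (snd i'))" if "i' \<in> index_set p t A C U" for i' A C U
    using index_set_coprime that by (metis prod.collapse)
  have L: "cusp_sum p (n + t) n A C U (\<lambda>a c. charfun (H1 N N' a c)) v =
      of_nat (card {j \<in> ?J. v \<in> H1 N N' (fst j) (snd j)})"
    unfolding cusp_sum_index_set[OF assms(1)] card_filter_eq_sum[OF fin(1)] sum_fun_at case_prod_unfold
    by (simp add: charfun_apply finite_H sum.If_cases fin)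
  have R: "cusp_sum p (n + t) n A' C' U' (\<lambda>a c. charfun (H2 N N' a c)) v =
      of_nat (card {j \<in> ?J'. v \<in> H2 N N' (fst j) (snd j)})"
    unfolding cusp_sum_index_set[OF assms(2)] card_filter_eq_sum[OF fin(2)] sum_fun_at case_prod_unfold
    by (simp add: charfun_apply finite_H sum.If_cases fin)
  have "card {j \<in> ?J. v \<in> H1 N N' (fst j) (snd j)} = card {j \<in> ?J'. v \<in> H2 N N' (fst j) (snd j)}"
  proof (cases "\<exists>w x y z. v = dual_coset N N' w x y z")
    case True
    then obtain w x y z where v: "v = dual_coset N N' w x y z" by blast
    have "{j \<in> ?J. v \<in> H1 N N' (fst j) (snd j)} =
        {j \<in> ?J. type_cond p n t (int (fst j)) (int (snd j)) w x y z}"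
      using cop by (auto simp: H1_def v)
    moreover have "{j \<in> ?J'. v \<in> H2 N N' (fst j) (snd j)} =
        {j \<in> ?J'. type_cond p n t (int (fst j)) (int (snd j)) w x (- z) (- y)}"
      using cop by (auto simp: H2_def v)
    ultimately show ?thesis
      using sol_count_swap[OF prime_p n_ge] by (simp add: card_index_set assms)
  next
    case False
    \<comment> \<open>Functions here are defined on all sets of matrices; off the discriminant group
      both counts are 0.\<close>
    then have "v \<notin> type_of N N' I" for I
      using type_of_subset_cosets[OF N_eq N_pos] by blast
    then show ?thesis by (simp add: H1_def H2_def)
  qed
  then show "cusp_sum p (n + t) n A C U (\<lambda>a c. charfun (H1 N N' a c)) v =
    cusp_sum p (n + t) n A' C' U' (\<lambda>a c. charfun (H2 N N' a c)) v"
    unfolding L R by simp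
qed

text \<open>Injectivity rules out repeated types, so every coefficient of this formal sum is 0 or
  1.\<close>

lemma cusp_sum_basis_elt:
  assumes "rep_system p (n + t) n A C U"
    and inj: "inj_on (\<lambda>j. F (fst j) (snd j)) (index_set p t A C U)"
  shows "cusp_sum p (n + t) n A C U (\<lambda>a c. basis_elt (F a c)) H =
    (if H \<in> (\<lambda>j. F (fst j) (snd j)) ` index_set p t A C U then 1 else 0)"
proof -
  have "cusp_sum p (n + t) n A C U (\<lambda>a c. basis_elt (F a c)) H =
      (\<Sum>j\<in>index_set p t A C U. if H = F (fst j) (snd j) then 1 else 0)"
    unfolding cusp_sum_index_set[OF assms(1)] sum_fun_at case_prod_unfold basis_elt_def ..
  also have "\<dots> = (\<Sum>K\<in>(\<lambda>j. F (fst j) (snd j)) ` index_set p t A C U. if H = K then 1 else 0)"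
    by (simp add: sum.reindex[OF inj])
  finally show ?thesis using finite_index_set[OF assms(1)] by simp
qed

end

text \<open>Uniqueness concerns coefficients indexed by types and not by cusps. Therefore
  \<open>\<rho>\<close> is formed in the space of formal combinations of types, where coinciding
  types would add up or cancel, and its not being zero is a separate claim. The two sides may use
  different systems of representatives.\<close>

theorem proposition1p2:
  fixes p r r' N N' :: nat
    and A C A' C' :: "nat set"
    and U U' :: "nat \<Rightarrow> nat set"
  assumes "prime p" and "1 \<le> r'" and "r' \<le> r"
    and "N = p ^ r" and "N' = p ^ r'"
    and "rep_system p r r' A C U" and "rep_system p r r' A' C' U'"
  defines "\<rho> \<equiv> cusp_sum p r r' A C U (\<lambda>a c. basis_elt (H1 N N' a c))
             - cusp_sum p r r' A' C' U' (\<lambda>a c. basis_elt (H2 N N' a c))"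
  shows "cusp_sum p r r' A C U (\<lambda>a c. charfun (H1 N N' a c))
           = cusp_sum p r r' A' C' U' (\<lambda>a c. charfun (H2 N N' a c))
    \<and> (\<exists>H\<in>Types N N'. \<rho> H \<noteq> 0)
    \<and> (\<forall>k :: (rat^2^2) set set \<Rightarrow> complex.
         (\<Sum>H\<in>Types N N'. smult (k H) (charfun H)) = 0
           \<longleftrightarrow> (\<exists>t. \<forall>H\<in>Types N N'. k H = t * \<rho> H))"
proof -
  define t where "t = r - r'"
  have r: "r = r' + t" using assms(3) by (simp add: t_def)
  interpret cusp_types p r' t N N'
    using assms by unfold_locales (simp_all add: r)
  note reps = assms(6)[unfolded r] and reps' = assms(7)[unfolded r]
  let ?J = "index_set p t A C U" and ?J' = "index_set p t A' C' U'"
  let ?S = "types1 ?J" and ?T = "types2 ?J'"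
  note disj = types_disjoint[OF reps reps']
  have \<rho>: "\<rho> H = (if H \<in> ?S then 1 else 0) - (if H \<in> ?T then 1 else 0)" for H
    unfolding \<rho>_def r fun_diff_def cusp_sum_basis_elt[OF reps inj_on_H1[OF reps]]
      cusp_sum_basis_elt[OF reps' inj_on_H2[OF reps']] ..
  have \<rho>1: "\<rho> H = 1" if "H \<in> ?S" for H
    using that disj unfolding \<rho> by auto
  have \<rho>2: "\<rho> H = - 1" if "H \<in> ?T" for H
    using that disj unfolding \<rho> by auto
  have ne: "?S \<noteq> {}" "?T \<noteq> {}"
    using index_set_nonempty reps reps' by blast+
  have rel: "cusp_sum p r r' A C U (\<lambda>a c. charfun (H1 N N' a c))
           = cusp_sum p r r' A' C' U' (\<lambda>a c. charfun (H2 N N' a c))"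
    unfolding r by (rule charfun_relation[OF reps reps'])
  have types_rel: "(\<Sum>H\<in>?S. charfun H) = (\<Sum>H\<in>?T. charfun H)"
    using rel unfolding r cusp_sum_index_set[OF reps] cusp_sum_index_set[OF reps']
      sum.reindex[OF inj_on_H1[OF reps]] sum.reindex[OF inj_on_H2[OF reps']]
    by (simp add: case_prod_unfold)
  have sep: "\<exists>v\<in>H \<inter> K. (\<forall>H'\<in>?S. v \<in> H' \<longrightarrow> H' = H) \<and> (\<forall>K'\<in>?T. v \<in> K' \<longrightarrow> K' = K)"
    if HK: "H \<in> ?S" "K \<in> ?T" for H K
  proof -
    obtain i j where ij: "i \<in> ?J" "j \<in> ?J'"
      and H: "H = H1 N N' (fst i) (snd i)" and K: "K = H2 N N' (fst j) (snd j)"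
      using HK by blast
    show ?thesis using separating_coset[OF reps reps' ij] unfolding H K by blast
  qed
  have "(\<Sum>H\<in>Types N N'. smult (k H) (charfun H)) = 0 \<longleftrightarrow> (\<exists>t. \<forall>H\<in>Types N N'. k H = t * \<rho> H)"
    for k :: "(rat^2^2) set set \<Rightarrow> complex"
    unfolding Types_eq[OF reps reps']
    using finite_index_set[OF reps] finite_index_set[OF reps'] disj ne sep types_rel \<rho>1 \<rho>2
    by (intro relation_unique) (auto simp: finite_H)
  moreover have "\<exists>H\<in>Types N N'. \<rho> H \<noteq> 0"
    unfolding Types_eq[OF reps reps'] using ne(1) \<rho>1 by fastforce
  ultimately show ?thesis using rel by blast
qed

end
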